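(* Let $E|k$ be a tamely ramified finite extension of non-Archimedean local fields. Then $\mu_{tame}(E|k)$ is non-empty and is an equivalence class of $\sim_{E|k}$, and the following are equivalent: 1. $E$ is $k$-isomorphic to $K\otimes_kU$ with $K|k$ totally ramified and $U|k$ unramified; 2. $E$ contains an $e$-th root of some uniformizer of $k$; 3. $1\in\mu_{tame}(E|k)$; 4. there exist uniformizers $\pi_E$ of $E$ and $\pi_k$ of $k$ with $(\pi_E^e/\pi_k)^{(q_E-1)/\tilde e}\in1+\mathfrak p_E$; 5. for all uniformizers $\pi_E$ of $E$ and $\pi_k$ of $k$, $(\pi_E^e/\pi_k)^{(q_E-1)/\tilde e}\in1+\mathfrak p_E$.
   Context: $e=e(E|k)$, $f=f(E|k)$; $q=\#\kappa_k$, $q_E=\#\kappa_E$ are the residue field cardinalities; $\tilde e:=\gcd\big(\frac{q_E-1}{q-1},e\big)$. $\mu_i(E)$ is the set of $i$-th roots of unity in $E$. $\mu_{tame}(E|k):=\{x\in\mu_{q_E-1}(E):\ \exists$ a uniformizer $\pi_E$ of $E$ with $\pi_E^ex^{-1}\in o_k\}$. On $\mu_{q_E-1}(E)$ define $x\sim_{E|k}y$ iff $(x/y)^{(q_E-1)/\tilde e}=1$. *)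

theory Defs
  imports Main
begin

text \<open>A non-Archimedean local field E is modelled as a field type 'a together with its
normalized discrete valuation v (the value of v at 0 is irrelevant). A subfield k of E
is given as a set; its valuation is the restriction of v.\<close>

definition is_subfield :: "'a::field set \<Rightarrow> bool" where
  "is_subfield S \<longleftrightarrow> 0 \<in> S \<and> 1 \<in> S \<and>
     (\<forall>x\<in>S. \<forall>y\<in>S. x + y \<in> S \<and> x - y \<in> S \<and> x * y \<in> S) \<and>
     (\<forall>x\<in>S. x \<noteq> 0 \<longrightarrow> inverse x \<in> S)"

definition discrete_valuation :: "('a::field \<Rightarrow> int) \<Rightarrow> bool" where
  "discrete_valuation v \<longleftrightarrow>
     (\<forall>x y. x \<noteq> 0 \<longrightarrow> y \<noteq> 0 \<longrightarrow> v (x * y) = v x + v y) \<and>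
     (\<forall>x y. x \<noteq> 0 \<longrightarrow> y \<noteq> 0 \<longrightarrow> x + y \<noteq> 0 \<longrightarrow> min (v x) (v y) \<le> v (x + y)) \<and>
     (\<exists>x. x \<noteq> 0 \<and> v x = 1)"

definition val_ring :: "('a::field \<Rightarrow> int) \<Rightarrow> 'a set" where
  "val_ring v = {x. x = 0 \<or> 0 \<le> v x}"

definition val_ideal :: "('a::field \<Rightarrow> int) \<Rightarrow> 'a set" where
  "val_ideal v = {x. x = 0 \<or> 0 < v x}"

definition residue_field :: "'a::field set \<Rightarrow> ('a \<Rightarrow> int) \<Rightarrow> 'a set set" where
  "residue_field S v =
     (\<lambda>x. {y \<in> S \<inter> val_ring v. x - y \<in> val_ideal v}) ` (S \<inter> val_ring v)"

definition res_card :: "'a::field set \<Rightarrow> ('a \<Rightarrow> int) \<Rightarrow> nat" where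
  "res_card S v = card (residue_field S v)"

definition complete_on :: "'a::field set \<Rightarrow> ('a \<Rightarrow> int) \<Rightarrow> bool" where
  "complete_on S v \<longleftrightarrow>
     (\<forall>X :: nat \<Rightarrow> 'a. (\<forall>n. X n \<in> S) \<longrightarrow>
        (\<forall>N::int. \<exists>M. \<forall>m\<ge>M. \<forall>n\<ge>M. X m = X n \<or> N \<le> v (X m - X n)) \<longrightarrow>
        (\<exists>L\<in>S. \<forall>N::int. \<exists>M. \<forall>n\<ge>M. X n = L \<or> N \<le> v (X n - L)))"

definition nonarch_local_field :: "('a::field \<Rightarrow> int) \<Rightarrow> bool" where
  "nonarch_local_field v \<longleftrightarrow> discrete_valuation v \<and> complete_on UNIV v \<and>
     finite (residue_field UNIV v)"

definition nonarch_local_subfield :: "'a::field set \<Rightarrow> ('a \<Rightarrow> int) \<Rightarrow> bool" where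
  "nonarch_local_subfield k v \<longleftrightarrow> is_subfield k \<and> (\<exists>x\<in>k. x \<noteq> 0 \<and> v x \<noteq> 0) \<and>
     complete_on k v \<and> finite (residue_field k v)"

definition vmin :: "'a::field set \<Rightarrow> ('a \<Rightarrow> int) \<Rightarrow> nat" where
  "vmin S v = (LEAST n::nat. 0 < n \<and> (\<exists>x\<in>S. x \<noteq> 0 \<and> v x = int n))"

definition ram_index :: "('a::field \<Rightarrow> int) \<Rightarrow> 'a set \<Rightarrow> 'a set \<Rightarrow> nat" where
  "ram_index v L k = vmin k v div vmin L v"

definition lin_indep_over :: "'a::field set \<Rightarrow> 'a set \<Rightarrow> bool" where
  "lin_indep_over k B \<longleftrightarrow>
     (\<forall>c. (\<forall>b\<in>B. c b \<in> k) \<longrightarrow> (\<Sum>b\<in>B. c b * b) = 0 \<longrightarrow> (\<forall>b\<in>B. c b = 0))"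

definition spans_over :: "'a::field set \<Rightarrow> 'a set \<Rightarrow> 'a set \<Rightarrow> bool" where
  "spans_over k B L \<longleftrightarrow> (\<forall>x\<in>L. \<exists>c. (\<forall>b\<in>B. c b \<in> k) \<and> x = (\<Sum>b\<in>B. c b * b))"

definition basis_over :: "'a::field set \<Rightarrow> 'a set \<Rightarrow> 'a set \<Rightarrow> bool" where
  "basis_over k L B \<longleftrightarrow> finite B \<and> B \<subseteq> L \<and> lin_indep_over k B \<and> spans_over k B L"

definition finite_ext :: "'a::field set \<Rightarrow> 'a set \<Rightarrow> bool" where
  "finite_ext k L \<longleftrightarrow> (\<exists>B. basis_over k L B)"

definition degree :: "'a::field set \<Rightarrow> 'a set \<Rightarrow> nat" where
  "degree k L = card (SOME B. basis_over k L B)"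

definition residue_char :: "('a::field \<Rightarrow> int) \<Rightarrow> nat" where
  "residue_char v = (LEAST p::nat. 0 < p \<and> (of_nat p :: 'a) \<in> val_ideal v)"

text \<open>Tamely ramified: residue characteristic does not divide e (the residue field
extension, being an extension of finite fields, is automatically separable).\<close>
definition tamely_ramified :: "('a::field \<Rightarrow> int) \<Rightarrow> 'a set \<Rightarrow> 'a set \<Rightarrow> bool" where
  "tamely_ramified v L k \<longleftrightarrow> \<not> residue_char v dvd ram_index v L k"

definition totally_ramified :: "('a::field \<Rightarrow> int) \<Rightarrow> 'a set \<Rightarrow> 'a set \<Rightarrow> bool" where
  "totally_ramified v L k \<longleftrightarrow> ram_index v L k = degree k L"

definition unramified :: "('a::field \<Rightarrow> int) \<Rightarrow> 'a set \<Rightarrow> 'a set \<Rightarrow> bool" where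
  "unramified v L k \<longleftrightarrow> ram_index v L k = 1"

text \<open>The multiplication map K \<otimes>_k U \<rightarrow> E is bijective: for some k-basis B of U, every
element of E is uniquely a K-linear combination of B (i.e. 1 \<otimes> B, a K-basis of K \<otimes>_k U,
maps to a K-basis of E).\<close>
definition tensor_iso :: "'a::field set \<Rightarrow> 'a set \<Rightarrow> 'a set \<Rightarrow> bool" where
  "tensor_iso k K U \<longleftrightarrow> (\<exists>B. basis_over k U B \<and>
     (\<forall>x::'a. \<exists>!a. (\<forall>b\<in>B. a b \<in> K) \<and> (\<forall>b. b \<notin> B \<longrightarrow> a b = 0) \<and> x = (\<Sum>b\<in>B. a b * b)))"

definition uniformizer :: "('a::field \<Rightarrow> int) \<Rightarrow> 'a \<Rightarrow> bool" where
  "uniformizer v x \<longleftrightarrow> x \<noteq> 0 \<and> v x = 1"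

definition uniformizer_sub :: "'a::field set \<Rightarrow> ('a \<Rightarrow> int) \<Rightarrow> 'a \<Rightarrow> bool" where
  "uniformizer_sub k v x \<longleftrightarrow> x \<in> k \<and> x \<noteq> 0 \<and> v x = int (vmin k v)"

definition roots_of_unity :: "nat \<Rightarrow> 'a::field set" where
  "roots_of_unity n = {x. x ^ n = 1}"

definition e_tilde :: "'a::field set \<Rightarrow> ('a \<Rightarrow> int) \<Rightarrow> nat" where
  "e_tilde k v = gcd ((res_card UNIV v - 1) div (res_card k v - 1)) (ram_index v UNIV k)"

definition mu_tame :: "'a::field set \<Rightarrow> ('a \<Rightarrow> int) \<Rightarrow> 'a set" where
  "mu_tame k v = {x \<in> roots_of_unity (res_card UNIV v - 1).
      \<exists>\<pi>. uniformizer v \<pi> \<and> \<pi> ^ ram_index v UNIV k * inverse x \<in> k \<inter> val_ring v}"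

definition sim_rel :: "'a::field set \<Rightarrow> ('a \<Rightarrow> int) \<Rightarrow> 'a \<Rightarrow> 'a \<Rightarrow> bool" where
  "sim_rel k v x y \<longleftrightarrow> (x / y) ^ ((res_card UNIV v - 1) div e_tilde k v) = 1"

end

theory Submission
  imports Defs "HOL-Computational_Algebra.Polynomial" "HOL-Computational_Algebra.Primes"
begin

text \<open>By Hensel's lemma every unit of \<open>E\<close> is a root of unity of order dividing \<open>q_E - 1\<close> times a
  1-unit, and, the ramification being tame, every 1-unit is an \<open>e\<close>-th power. Hence the class of
  \<open>\<pi>_E^e / \<pi>_k\<close> modulo \<open>e\<close>-th powers of units and units of \<open>k\<close> is represented by a root of unity,
  and counting in the cyclic group of these roots identifies the indeterminacy with the kernel of
  the power map with exponent \<open>(q_E - 1) / e~\<close>.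

  If \<open>E = K U\<close> with \<open>K\<close> totally ramified and \<open>U\<close> unramified, then lifts of a residue basis of \<open>U\<close>
  span \<open>E\<close> over \<open>K\<close>, and \<open>K\<close> has the residue field of \<open>k\<close>, so \<open>K\<close> contains a uniformizer of \<open>E\<close>;
  correcting it by a 1-unit gives an \<open>e\<close>-th root of a uniformizer of \<open>k\<close>. Conversely such a root
  \<open>y\<close> generates \<open>K\<close>, and \<open>U\<close> is generated by a Hensel lift of a generator of the residue field.\<close>

section \<open>Valuations and subfields\<close>

text \<open>The residue field is never made into a ring: it is reached through congruences modulo
  \<open>vball v 1\<close> and finite systems of representatives, so that sums, products and linear
  independence over it become statements about elements of E.

  The constant \<open>et\<close> arises as follows. A change of uniformizer of E multiplies
  \<open>\<pi>^e / \<pi>k\<close> by the e-th power of a unit, a change of \<open>\<pi>k\<close>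
  multiplies it by a unit of k. Modulo 1-units these factors fill the product of the e-th powers in
  the cyclic group of order N = q_E - 1 with its subgroup of order M = q - 1, and that subgroup
  consists of the (N div M)-th powers. The product is the group of powers with exponent gcd(N div M,
  e).

  The decomposition is handled without the formula n = e f. The valuation of a combination of
  residually independent elements is that of one of its coefficients, which separates K from U, and
  completeness of k turns spanning modulo p_k into spanning.\<close>

definition vball :: "('a::field \<Rightarrow> int) \<Rightarrow> int \<Rightarrow> 'a set" where
  "vball v n = {x. x = 0 \<or> n \<le> v x}"

lemma val_ring_eq_vball: "val_ring v = vball v 0"
  by (simp add: val_ring_def vball_def)

lemma val_ideal_eq_vball: "val_ideal v = vball v 1"
  by (auto simp: val_ideal_def vball_def)

lemma is_subfield_UNIV: "is_subfield UNIV"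
  by (simp add: is_subfield_def)

locale subring_set =
  fixes S :: "'a::field set"
  assumes zero_mem [simp]: "0 \<in> S" and one_mem [simp]: "1 \<in> S"
    and add_mem [intro]: "x \<in> S \<Longrightarrow> y \<in> S \<Longrightarrow> x + y \<in> S"
    and diff_mem [intro]: "x \<in> S \<Longrightarrow> y \<in> S \<Longrightarrow> x - y \<in> S"
    and mult_mem [intro]: "x \<in> S \<Longrightarrow> y \<in> S \<Longrightarrow> x * y \<in> S"
begin

lemma uminus_mem [intro]: "x \<in> S \<Longrightarrow> - x \<in> S"
  using diff_mem[of 0 x] by simp

lemma power_mem [intro]: "x \<in> S \<Longrightarrow> x ^ n \<in> S"
  by (induction n) auto

lemma sum_mem [intro]: "(\<And>i. i \<in> I \<Longrightarrow> f i \<in> S) \<Longrightarrow> sum f I \<in> S"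
  by (induction I rule: infinite_finite_induct) auto

lemma of_nat_mem [simp]: "of_nat n \<in> S"
  by (induction n) auto

end

locale subfield_set =
  fixes S :: "'a::field set"
  assumes is_subfield: "is_subfield S"

sublocale subfield_set \<subseteq> subring_set
  using is_subfield by unfold_locales (auto simp: is_subfield_def)

context subfield_set
begin

lemma inverse_mem [intro]: "x \<in> S \<Longrightarrow> inverse x \<in> S"
  using is_subfield by (cases "x = 0") (auto simp: is_subfield_def)

lemma divide_mem [intro]: "x \<in> S \<Longrightarrow> y \<in> S \<Longrightarrow> x / y \<in> S"
  by (auto simp: divide_inverse)

lemma power_int_mem [intro]: "x \<in> S \<Longrightarrow> x powi n \<in> S"
  by (auto simp: power_int_def)

end

lemma subfield_setI: "is_subfield S \<Longrightarrow> subfield_set S"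
  by unfold_locales

locale valued_field =
  fixes v :: "'a::field \<Rightarrow> int"
  assumes dv: "discrete_valuation v"
begin

lemma v_mult: "x \<noteq> 0 \<Longrightarrow> y \<noteq> 0 \<Longrightarrow> v (x * y) = v x + v y"
  using dv by (auto simp: discrete_valuation_def)

lemma v_add: "x \<noteq> 0 \<Longrightarrow> y \<noteq> 0 \<Longrightarrow> x + y \<noteq> 0 \<Longrightarrow> min (v x) (v y) \<le> v (x + y)"
  using dv by (auto simp: discrete_valuation_def)

lemma v_one [simp]: "v 1 = 0"
  using v_mult[of 1 1] by simp

lemma v_minus_one [simp]: "v (- 1) = 0"
  using v_mult[of "-1" "-1"] by simp

lemma v_uminus [simp]: "v (- x) = v x"
  using v_mult[of "-1" x] by (cases "x = 0") auto

lemma v_inverse: "x \<noteq> 0 \<Longrightarrow> v (inverse x) = - v x"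
  using v_mult[of x "inverse x"] by simp

lemma v_divide: "x \<noteq> 0 \<Longrightarrow> y \<noteq> 0 \<Longrightarrow> v (x / y) = v x - v y"
  by (simp add: divide_inverse v_mult v_inverse)

lemma v_power: "x \<noteq> 0 \<Longrightarrow> v (x ^ n) = int n * v x"
  by (induction n) (auto simp: v_mult algebra_simps)

lemma v_power_int: "x \<noteq> 0 \<Longrightarrow> v (x powi n) = n * v x"
  by (auto simp: power_int_def v_power v_inverse)

abbreviation P :: "int \<Rightarrow> 'a set" where "P n \<equiv> vball v n"

lemma vball_zero [simp]: "0 \<in> P n"
  by (simp add: vball_def)

lemma vball_one [simp]: "1 \<in> P 0"
  by (simp add: vball_def)

lemma one_notin_ideal [simp]: "1 \<notin> P 1"
  by (simp add: vball_def)

lemma vball_mono: "x \<in> P m \<Longrightarrow> n \<le> m \<Longrightarrow> x \<in> P n"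
  by (auto simp: vball_def)

lemma vball_add [intro]: "x \<in> P n \<Longrightarrow> y \<in> P n \<Longrightarrow> x + y \<in> P n"
  using v_add[of x y] by (cases "x = 0"; cases "y = 0"; cases "x + y = 0") (auto simp: vball_def)

lemma vball_uminus [intro]: "x \<in> P n \<Longrightarrow> - x \<in> P n"
  by (auto simp: vball_def)

lemma vball_diff [intro]: "x \<in> P n \<Longrightarrow> y \<in> P n \<Longrightarrow> x - y \<in> P n"
  using vball_add[of x n "- y"] by auto

lemma vball_diff_commute: "x - y \<in> P n \<Longrightarrow> y - x \<in> P n"
  using vball_uminus[of "x - y" n] by simp

lemma vball_mult: "x \<in> P m \<Longrightarrow> y \<in> P n \<Longrightarrow> x * y \<in> P (m + n)"
  by (cases "x = 0"; cases "y = 0") (auto simp: vball_def v_mult)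

lemma vball_mult_left: "x \<in> P 0 \<Longrightarrow> y \<in> P n \<Longrightarrow> x * y \<in> P n"
  using vball_mult[of x 0 y n] by simp

lemma vball_mult_right: "x \<in> P n \<Longrightarrow> y \<in> P 0 \<Longrightarrow> x * y \<in> P n"
  using vball_mult[of x n y 0] by simp

lemma vball_power [intro]: "x \<in> P 0 \<Longrightarrow> x ^ n \<in> P 0"
  by (induction n) (auto intro: vball_mult_left)

lemma vball_sum [intro]: "(\<And>i. i \<in> I \<Longrightarrow> f i \<in> P n) \<Longrightarrow> sum f I \<in> P n"
  by (induction I rule: infinite_finite_induct) auto

lemma vball_of_nat [simp]: "of_nat n \<in> P 0"
  by (induction n) (auto)

lemma vball_trans: "x - y \<in> P n \<Longrightarrow> y - z \<in> P n \<Longrightarrow> x - z \<in> P n"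
  using vball_add[of "x - y" n "y - z"] by simp

lemma vball_all_imp_zero: assumes "\<And>n::nat. x \<in> P (int n)" shows "x = 0"
proof (rule ccontr)
  assume "x \<noteq> 0"
  with assms[of "nat (v x + 1)"] show False
    by (auto simp: vball_def split: if_splits)
qed

lemma unit_iff: "x \<in> P 0 - P 1 \<longleftrightarrow> x \<noteq> 0 \<and> v x = 0"
  by (auto simp: vball_def)

lemma unitD: "x \<in> P 0 \<Longrightarrow> x \<notin> P 1 \<Longrightarrow> x \<noteq> 0 \<and> v x = 0"
  using unit_iff by blast

lemma vball_divide_unit: "x \<in> P n \<Longrightarrow> y \<noteq> 0 \<Longrightarrow> v y = 0 \<Longrightarrow> x / y \<in> P n"
  by (cases "x = 0") (auto simp: vball_def v_divide)

lemma unit_cong: "x - y \<in> P 1 \<Longrightarrow> y \<noteq> 0 \<Longrightarrow> v y = 0 \<Longrightarrow> x \<noteq> 0 \<and> v x = 0"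
proof -
  assume a: "x - y \<in> P 1" "y \<noteq> 0" "v y = 0"
  have y: "y \<in> P 0" "y \<notin> P 1" using a unit_iff[of y] by auto
  have "x = (x - y) + y" by simp
  then have "x \<in> P 0" using a(1) y(1) by (metis vball_add vball_mono zero_le_one)
  moreover have "x \<notin> P 1"
    using a(1) y(2) vball_diff[of x 1 "x - y"] by auto
  ultimately show ?thesis using unitD by blast
qed

lemma cong_mult:
  assumes "x - x' \<in> P n" "y - y' \<in> P n" "x \<in> P 0" "y' \<in> P 0"
  shows "x * y - x' * y' \<in> P n"
proof -
  have "x * y - x' * y' = x * (y - y') + (x - x') * y'" by (simp add: algebra_simps)
  with assms show ?thesis by (metis vball_add vball_mult_left vball_mult_right)
qed

lemma cong_power:
  assumes "x - y \<in> P n" "x \<in> P 0" "y \<in> P 0"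
  shows "x ^ m - y ^ m \<in> P n"
  by (induction m) (use assms in \<open>auto intro: cong_mult\<close>)

lemma cong_divide:
  assumes "x - y \<in> P n" "u \<noteq> 0" "v u = 0"
  shows "x / u - y / u \<in> P n"
  using vball_divide_unit[OF assms] by (simp add: diff_divide_distrib)

lemma vball_prod: "(\<And>i. i \<in> I \<Longrightarrow> f i \<in> P 0) \<Longrightarrow> prod f I \<in> P 0"
  by (induction I rule: infinite_finite_induct) (auto intro: vball_mult_left)

lemma cong_prod:
  assumes "\<And>i. i \<in> I \<Longrightarrow> f i - g i \<in> P n" "\<And>i. i \<in> I \<Longrightarrow> f i \<in> P 0"
    "\<And>i. i \<in> I \<Longrightarrow> g i \<in> P 0"
  shows "prod f I - prod g I \<in> P n"
  using assms
  by (induction I rule: infinite_finite_induct) (auto intro!: cong_mult vball_prod)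

lemma vmin_UNIV: "vmin UNIV v = 1"
proof -
  obtain x where "x \<noteq> 0" "v x = 1" using dv by (auto simp: discrete_valuation_def)
  then show ?thesis unfolding vmin_def by (intro Least_equality) auto
qed

lemma uniformizer_exists: "\<exists>x. uniformizer v x"
  using dv by (auto simp: discrete_valuation_def uniformizer_def)

text \<open>Division with remainder shows that \<open>residue_char v\<close>, defined only as a
  least element, divides every n whose image lies in p. The hypothesis \<open>ex\<close> guarantees
  that the least element is attained.\<close>

lemma of_nat_unit_if_not_residue_char_dvd:
  assumes nd: "\<not> residue_char v dvd n" and ex: "\<exists>p>0. of_nat p \<in> P 1"
  shows "of_nat n \<notin> P 1"
proof
  assume n: "of_nat n \<in> P 1"
  define p where "p = residue_char v"
  have p: "0 < p \<and> (of_nat p :: 'a) \<in> P 1"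
    using LeastI_ex[OF ex] unfolding p_def residue_char_def val_ideal_eq_vball by auto
  have least: "p \<le> r" if "0 < r" "(of_nat r :: 'a) \<in> P 1" for r
    unfolding p_def residue_char_def val_ideal_eq_vball by (rule Least_le) (use that in auto)
  have "(of_nat (n mod p) :: 'a) = of_nat n - of_nat (n div p) * of_nat p"
    by (metis (no_types, lifting) add_diff_cancel_left' div_mult_mod_eq of_nat_add of_nat_mult)
  then have "(of_nat (n mod p) :: 'a) \<in> P 1"
    using n p by (metis vball_diff vball_mult_left vball_of_nat)
  moreover have "0 < n mod p" using nd by (auto simp: p_def dvd_eq_mod_eq_0)
  ultimately show False using least[of "n mod p"] p by (meson mod_less_divisor not_less)
qed

end

locale valued_subfield = valued_field v + subfield_set S for v :: "'a::field \<Rightarrow> int" and S +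
  assumes nontrivial: "\<exists>x\<in>S. x \<noteq> 0 \<and> v x \<noteq> 0"
begin

lemma vmin_attained: "0 < vmin S v \<and> (\<exists>x\<in>S. x \<noteq> 0 \<and> v x = int (vmin S v))"
  unfolding vmin_def
proof (rule LeastI_ex)
  obtain x where x: "x \<in> S" "x \<noteq> 0" "v x \<noteq> 0" using nontrivial by auto
  show "\<exists>n::nat. 0 < n \<and> (\<exists>x\<in>S. x \<noteq> 0 \<and> v x = int n)"
  proof (cases "v x > 0")
    case True
    then show ?thesis using x by (intro exI[of _ "nat (v x)"]) auto
  next
    case False
    then show ?thesis using x
      by (intro exI[of _ "nat (- v x)"] conjI bexI[of _ "inverse x"]) (auto simp: v_inverse)
  qed
qed

lemma vmin_pos: "0 < vmin S v"
  using vmin_attained by blast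

lemma uniformizer_sub_exists: "\<exists>x. uniformizer_sub S v x"
  using vmin_attained by (auto simp: uniformizer_sub_def)

text \<open>The value group of \<open>S\<close> is a subgroup of the integers, hence generated by
  its least positive element: otherwise the quotient \<open>z\<close> would realize a smaller
  positive remainder.\<close>

lemma vmin_dvd:
  assumes "x \<in> S" "x \<noteq> 0"
  shows "int (vmin S v) dvd v x"
proof (rule ccontr)
  assume nd: "\<not> int (vmin S v) dvd v x"
  define m where "m = int (vmin S v)"
  have m: "m > 0" using vmin_pos by (simp add: m_def)
  obtain t where t: "t \<in> S" "t \<noteq> 0" "v t = m" using vmin_attained by (auto simp: m_def)
  define z where "z = x / t powi (v x div m)"
  have tz: "t powi (v x div m) \<noteq> 0" using t by auto
  have "z \<noteq> 0" "z \<in> S" using assms t by (auto simp: z_def power_int_mem)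
  moreover have vz: "v z = v x mod m"
    unfolding z_def using assms t tz
    by (simp add: v_divide v_power_int minus_div_mult_eq_mod)
  moreover have "0 < v x mod m"
    using m nd by (metis dvd_eq_mod_eq_0 m_def order_le_less pos_mod_sign)
  ultimately have "vmin S v \<le> nat (v x mod m)"
    unfolding vmin_def by (intro Least_le) auto
  then have "m \<le> v x mod m" using m by (simp add: m_def le_nat_iff)
  then show False using pos_mod_bound[OF m, of "v x"] by simp
qed

text \<open>No valuation of \<open>S\<close> lies strictly between 0 and \<open>vmin S v\<close>.
  For an unramified subfield this turns a congruence modulo p_E into one modulo p_k.\<close>

lemma ideal_mem_vmin:
  assumes "x \<in> S" "x \<in> P 1"
  shows "x \<in> P (int (vmin S v))"
proof (cases "x = 0")
  case False
  with assms have "v x > 0" by (auto simp: vball_def)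
  then show ?thesis using vmin_dvd[OF assms(1) False] zdvd_imp_le by (auto simp: vball_def)
qed auto

end

section \<open>Hensel's lemma\<close>

definition coeffs_in :: "'a::field set \<Rightarrow> 'a poly \<Rightarrow> bool" where
  "coeffs_in R p \<longleftrightarrow> (\<forall>i. coeff p i \<in> R)"

context subring_set
begin

lemma poly_mem: "coeffs_in S p \<Longrightarrow> x \<in> S \<Longrightarrow> poly p x \<in> S"
  by (auto simp: poly_altdef coeffs_in_def)

lemma coeffs_in_0 [simp]: "coeffs_in S 0" and coeffs_in_1 [simp]: "coeffs_in S 1"
  by (auto simp: coeffs_in_def)

lemma coeffs_in_add: "coeffs_in S p \<Longrightarrow> coeffs_in S q \<Longrightarrow> coeffs_in S (p + q)"
  and coeffs_in_diff: "coeffs_in S p \<Longrightarrow> coeffs_in S q \<Longrightarrow> coeffs_in S (p - q)"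
  and coeffs_in_smult: "c \<in> S \<Longrightarrow> coeffs_in S p \<Longrightarrow> coeffs_in S (smult c p)"
  and coeffs_in_monom: "c \<in> S \<Longrightarrow> coeffs_in S (monom c n)"
  by (auto simp: coeffs_in_def)

lemma coeffs_in_mult: "coeffs_in S p \<Longrightarrow> coeffs_in S q \<Longrightarrow> coeffs_in S (p * q)"
  by (auto simp: coeffs_in_def coeff_mult)

lemma coeffs_in_pCons_iff: "coeffs_in S (pCons a p) \<longleftrightarrow> a \<in> S \<and> coeffs_in S p"
  unfolding coeffs_in_def by (metis coeff_pCons_0 coeff_pCons_Suc not0_implies_Suc)

lemma coeffs_in_pderiv: "coeffs_in S p \<Longrightarrow> coeffs_in S (pderiv p)"
  unfolding coeffs_in_def coeff_pderiv
  by (metis mult_mem of_nat_mem)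

text \<open>Induction along Horner's scheme keeps the second-order remainder in the ring itself, so
  over the integers of a subfield its contribution is at least as small as h^2.\<close>

lemma poly_taylor2:
  assumes "coeffs_in S p" "x \<in> S" "h \<in> S"
  shows "\<exists>r\<in>S. poly p (x + h) = poly p x + h * poly (pderiv p) x + h\<^sup>2 * r"
  using assms(1)
proof (induction p)
  case (pCons a p)
  from pCons.prems have p: "coeffs_in S p" by (simp add: coeffs_in_pCons_iff)
  then obtain r where r: "r \<in> S" "poly p (x + h) = poly p x + h * poly (pderiv p) x + h\<^sup>2 * r"
    using pCons.IH by blast
  show ?case
  proof (intro bexI)
    show "poly (pCons a p) (x + h) = poly (pCons a p) x + h * poly (pderiv (pCons a p)) x
        + h\<^sup>2 * (x * r + poly (pderiv p) x + h * r)"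
      using r(2) by (simp add: pderiv_pCons algebra_simps power2_eq_square)
    show "x * r + poly (pderiv p) x + h * r \<in> S"
      using r(1) assms(2,3) p by (intro add_mem mult_mem poly_mem coeffs_in_pderiv)
  qed
qed (auto intro: bexI[of _ 0])

text \<open>Because g is monic, quotient and remainder keep their coefficients in the ring. Bounding
  the remainder by vanishing coefficients also covers a constant \<open>g\<close>.\<close>

lemma monic_division:
  assumes g: "coeffs_in S g" "lead_coeff g = 1" and "coeffs_in S p"
  shows "\<exists>h r. coeffs_in S h \<and> coeffs_in S r \<and> p = g * h + r \<and>
    (\<forall>i\<ge>Polynomial.degree g. coeff r i = 0)"
  using assms(3)
proof (induction p)
  case 0
  then show ?case by (intro exI[of _ 0]) auto
next
  case (pCons a p)
  let ?d = "Polynomial.degree g"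
  from pCons.prems have a: "a \<in> S" and p: "coeffs_in S p" by (auto simp: coeffs_in_pCons_iff)
  then obtain h r where hr: "coeffs_in S h" "coeffs_in S r" "p = g * h + r"
      "\<forall>i\<ge>?d. coeff r i = 0" using pCons.IH by blast
  \<comment> \<open>Multiplying the old remainder by X reaches degree \<open>?d\<close> at most;
    \<open>c\<close> is the coefficient there, removed by subtracting \<open>c\<close> times
    \<open>g\<close>.\<close>
  define c where "c = coeff (pCons a r) ?d"
  have ar: "coeffs_in S (pCons a r)" using a hr by (simp add: coeffs_in_pCons_iff)
  then have c: "c \<in> S" by (simp add: c_def coeffs_in_def)
  show ?case
  proof (intro exI conjI)
    show "coeffs_in S (pCons c h)" using c hr by (simp add: coeffs_in_pCons_iff)
    show "coeffs_in S (pCons a r - smult c g)"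
      using c ar g by (intro coeffs_in_diff coeffs_in_smult)
    show "pCons a p = g * pCons c h + (pCons a r - smult c g)"
      using hr(3) by simp
    show "\<forall>i\<ge>?d. coeff (pCons a r - smult c g) i = 0"
    proof (intro allI impI)
      fix i assume i: "i \<ge> ?d"
      show "coeff (pCons a r - smult c g) i = 0"
      proof (cases "i = ?d")
        case True
        then show ?thesis using g(2) by (simp add: c_def)
      next
        case False
        then have "coeff g i = 0" "coeff (pCons a r) i = 0"
          using i hr(4) by (auto simp: coeff_eq_0 coeff_pCons split: nat.split)
        then show ?thesis by simp
      qed
    qed
  qed
qed

end

context valued_field
begin

lemma subring_set_vball: "subring_set (P 0)"
  by unfold_locales (auto intro: vball_mult_left)

lemma subring_set_Int_vball: "subfield_set S \<Longrightarrow> subring_set (S \<inter> P 0)"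
proof -
  assume "subfield_set S"
  then interpret subfield_set S .
  show ?thesis by unfold_locales (auto intro: vball_mult_left)
qed

lemma poly_cong:
  assumes "coeffs_in (P 0) p" "x - y \<in> P n" "x \<in> P 0" "y \<in> P 0"
  shows "poly p x - poly p y \<in> P n"
proof -
  have "poly p x - poly p y = (\<Sum>i\<le>Polynomial.degree p. coeff p i * (x ^ i - y ^ i))"
    by (simp add: poly_altdef sum_subtractf algebra_simps)
  then show ?thesis using assms cong_power[OF assms(2-4)]
    by (auto simp: coeffs_in_def intro!: vball_mult_left)
qed

text \<open>The ultrametric inequality makes control of consecutive terms enough for a Cauchy
  sequence, and the limit inherits the rate of convergence.\<close>

lemma complete_limit:
  assumes S: "complete_on S v" and X: "\<And>n. X n \<in> S"
    and step: "\<And>n. X (Suc n) - X n \<in> P (int n)"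
  shows "\<exists>L\<in>S. \<forall>n. X n - L \<in> P (int n)"
proof -
  have mono: "X (n + j) - X n \<in> P (int n)" for n j
  proof (induction j)
    case (Suc j)
    have "X (n + Suc j) - X (n + j) \<in> P (int n)"
      using vball_mono[OF step[of "n + j"], of "int n"] by simp
    then show ?case using Suc vball_trans by blast
  qed simp
  have cauchy: "\<exists>M. \<forall>m\<ge>M. \<forall>n\<ge>M. X m = X n \<or> N \<le> v (X m - X n)" for N :: int
  proof (intro exI allI impI)
    fix m n assume mn: "nat N \<le> m" "nat N \<le> n"
    have a: "X m' - X (nat N) \<in> P N" if "nat N \<le> m'" for m'
      using vball_mono[OF mono[of "nat N" "m' - nat N"], of N] that by simp
    have "X m - X n \<in> P N"
      using vball_trans[OF a[OF mn(1)] vball_diff_commute[OF a[OF mn(2)]]] .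
    then show "X m = X n \<or> N \<le> v (X m - X n)" by (auto simp: vball_def)
  qed
  obtain L where L: "L \<in> S" "\<And>N::int. \<exists>M. \<forall>n\<ge>M. X n = L \<or> N \<le> v (X n - L)"
    using S[unfolded complete_on_def, rule_format, OF X cauchy] by blast
  have "X n - L \<in> P (int n)" for n
  proof -
    obtain M where M: "\<And>m. m \<ge> M \<Longrightarrow> X m = L \<or> int n \<le> v (X m - L)" using L(2) by metis
    have "X (n + M) - L \<in> P (int n)" using M[of "n + M"] by (auto simp: vball_def)
    then show ?thesis using vball_trans[OF vball_diff_commute[OF mono[of n M]]] by blast
  qed
  with L(1) show ?thesis by blast
qed

text \<open>Newton iteration with the derivative frozen at the starting point: convergence is only
  linear, but each step gains a factor in the maximal ideal.\<close>

lemma hensel: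
  assumes S: "subfield_set S" "complete_on S v"
    and g: "coeffs_in (S \<inter> P 0) g"
    and x0: "x0 \<in> S" "x0 \<in> P 0"
    and root: "poly g x0 \<in> P 1" and simple: "poly (pderiv g) x0 \<notin> P 1"
  shows "\<exists>x\<in>S \<inter> P 0. poly g x = 0 \<and> x - x0 \<in> P 1"
proof -
  interpret R: subring_set "S \<inter> P 0" using subring_set_Int_vball[OF S(1)] .
  interpret F: subfield_set S by fact
  define D where "D = poly (pderiv g) x0"
  have DR: "D \<in> S \<inter> P 0" unfolding D_def using R.poly_mem[OF R.coeffs_in_pderiv[OF g]] x0 by blast
  have D: "D \<noteq> 0" "v D = 0" using unitD DR simple by (auto simp: D_def)
  have gP: "coeffs_in (P 0) g" "coeffs_in (P 0) (pderiv g)"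
    using g R.coeffs_in_pderiv[OF g] by (auto simp: coeffs_in_def)
  define X where "X = rec_nat x0 (\<lambda>_ x. x - poly g x / D)"
  have X0: "X 0 = x0" and XS: "X (Suc n) = X n - poly g (X n) / D" for n by (simp_all add: X_def)
  have inv: "X n \<in> S \<inter> P 0 \<and> X n - x0 \<in> P 1 \<and> poly g (X n) \<in> P (int n + 1)" for n
  proof (induction n)
    case 0
    then show ?case using x0 root by (simp add: X0)
  next
    case (Suc n)
    let ?x = "X n" and ?h = "- (poly g (X n) / D)"
    have h1: "?h \<in> P (int n + 1)" using Suc D by (auto intro: vball_divide_unit)
    have hR: "?h \<in> S \<inter> P 0"
    proof -
      have "poly g ?x \<in> S" using R.poly_mem[OF g] Suc by blast
      then have "?h \<in> S" using DR by (intro F.uminus_mem F.divide_mem) auto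
      moreover have "?h \<in> P 0" by (rule vball_mono[OF h1]) simp
      ultimately show ?thesis by blast
    qed
    obtain r where r: "r \<in> S \<inter> P 0"
      "poly g (?x + ?h) = poly g ?x + ?h * poly (pderiv g) ?x + ?h\<^sup>2 * r"
      using R.poly_taylor2[OF g _ hR, of ?x] Suc by blast
    \<comment> \<open>With the true derivative at \<open>?x\<close> the linear term would cancel.
      Using \<open>D\<close> leaves a defect that gains one order because the two derivatives agree
      modulo p; the quadratic term is small since 2(n + 1) is at least n + 2.\<close>
    have "D - poly (pderiv g) ?x \<in> P 1"
      unfolding D_def using poly_cong[OF gP(2), of x0 "X n" 1] Suc x0 vball_diff_commute by blast
    then have "(D - poly (pderiv g) ?x) / D \<in> P 1" using D by (intro vball_divide_unit)
    then have a: "poly g ?x * ((D - poly (pderiv g) ?x) / D) \<in> P (int n + 1 + 1)"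
      using vball_mult Suc by blast
    have "?h * ?h \<in> P ((int n + 1) + (int n + 1))" using h1 vball_mult by blast
    then have b: "?h\<^sup>2 * r \<in> P (int n + 1 + 1)"
      unfolding power2_eq_square using r(1)
      by (intro vball_mult_right[of "?h * ?h"]) (auto elim: vball_mono)
    have "poly g (?x + ?h) = poly g ?x * ((D - poly (pderiv g) ?x) / D) + ?h\<^sup>2 * r"
      using r(2) D by (simp add: field_simps)
    then have "poly g (X (Suc n)) \<in> P (int (Suc n) + 1)"
      using vball_add[OF a b] by (simp add: XS add.commute)
    moreover have "X (Suc n) \<in> S \<inter> P 0" using R.add_mem[of ?x ?h] Suc hR by (simp add: XS)
    moreover have "X (Suc n) - x0 \<in> P 1"
      using vball_add[of "?x - x0" 1 ?h] Suc vball_mono[OF h1, of 1] by (simp add: XS algebra_simps)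
    ultimately show ?case by blast
  qed
  have "X (Suc n) - X n \<in> P (int n)" for n
  proof -
    have "- (poly g (X n) / D) \<in> P (int n + 1)" using inv[of n] D by (auto intro: vball_divide_unit)
    then show ?thesis by (auto simp: XS elim: vball_mono)
  qed
  then obtain L where L: "L \<in> S" "\<And>n. X n - L \<in> P (int n)"
    using complete_limit[OF S(2), of X] inv by blast
  have L0: "L \<in> P 0"
    using L(2)[of 0] inv[of 0] vball_diff[of "X 0" 0 "X 0 - L"] by simp
  have "poly g L \<in> P (int n)" for n
    using poly_cong[OF gP(1) L(2)[of n]] inv[of n] L0
      vball_diff[of "poly g (X n)" "int n" "poly g (X n) - poly g L"]
      vball_mono[of "poly g (X n)" "int n + 1" "int n"]
    by auto
  then have "poly g L = 0" by (rule vball_all_imp_zero)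
  moreover have "L - x0 \<in> P 1"
    using vball_trans[OF vball_diff_commute, of "X 1" L 1 x0] L(2)[of 1] inv[of 1] by simp
  ultimately show ?thesis using L(1) L0 by blast
qed

text \<open>For X^n - a the derivative n x0^(n-1) is a unit as soon as n is one. The two uses are n
  = q - 1, giving Teichmueller representatives, and n = e, giving e-th roots of 1-units.\<close>

lemma hensel_root:
  assumes S: "subfield_set S" "complete_on S v"
    and n: "of_nat n \<notin> P 1"
    and a: "a \<in> S" "a \<in> P 0" and x0: "x0 \<in> S" "x0 \<noteq> 0" "v x0 = 0" "x0 ^ n - a \<in> P 1"
  shows "\<exists>x\<in>S. x ^ n = a \<and> x - x0 \<in> P 1"
proof -
  interpret R: subring_set "S \<inter> P 0" using subring_set_Int_vball[OF S(1)] .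
  define g where "g = monom 1 n - [:a:]"
  have "coeffs_in (S \<inter> P 0) g"
    unfolding g_def using a
    by (intro R.coeffs_in_diff R.coeffs_in_monom R.one_mem)
      (simp add: R.coeffs_in_pCons_iff)
  moreover have "poly g x = x ^ n - a" for x by (simp add: g_def poly_monom)
  moreover have "poly (pderiv g) x0 = of_nat n * x0 ^ (n - 1)"
    by (simp add: g_def pderiv_diff pderiv_monom poly_monom pderiv_pCons)
  moreover have "of_nat n * x0 ^ (n - 1) \<notin> P 1"
    using unitD[OF vball_of_nat n] x0
    by (auto simp: vball_def v_mult v_power)
  moreover have "x0 \<in> P 0" using x0 by (simp add: vball_def)
  ultimately show ?thesis using hensel[OF S, of g x0] x0 by auto
qed

text \<open>The factor 1 + x + ... + x^(n-1) of x^n - 1 is congruent to n, hence nonzero. Reduction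
  modulo p is therefore injective on the n-th roots of unity.\<close>

lemma root_unity_cong_one:
  assumes n: "of_nat n \<notin> P 1" and x: "x ^ n = 1" "x - 1 \<in> P 1"
  shows "x = 1"
proof -
  have x0: "x \<in> P 0" using unit_cong[OF x(2)] by (simp add: vball_def)
  have "(\<Sum>i<n. x ^ i) - (\<Sum>i<n. 1 ^ i) \<in> P 1"
    unfolding sum_subtractf[symmetric] using cong_power[OF x(2) x0 vball_one] by auto
  then have "(\<Sum>i<n. x ^ i) - of_nat n \<in> P 1" by simp
  then have "(\<Sum>i<n. x ^ i) \<noteq> 0"
    using unit_cong unitD[OF vball_of_nat n] by blast
  moreover have "(x - 1) * (\<Sum>i<n. x ^ i) = 0"
    using x(1) by (simp add: power_diff_1_eq[symmetric])
  ultimately show ?thesis by simp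
qed

end

section \<open>Residue fields and roots of unity\<close>

lemma finite_roots_of_unity: "n > 0 \<Longrightarrow> finite (roots_of_unity n :: 'a::field set)"
  and card_roots_of_unity_le: "n > 0 \<Longrightarrow> card (roots_of_unity n :: 'a::field set) \<le> n"
proof -
  assume n: "n > 0"
  define p :: "'a poly" where "p = monom 1 n - [:1:]"
  have deg: "Polynomial.degree p = n"
    unfolding p_def using n
    by (subst diff_conv_add_uminus, subst degree_add_eq_left) (auto simp: degree_monom_eq)
  then have p: "p \<noteq> 0" using n by auto
  have r: "roots_of_unity n = {x. poly p x = 0}"
    by (auto simp: roots_of_unity_def p_def poly_monom)
  show "finite (roots_of_unity n :: 'a set)" using poly_roots_finite[OF p] r by simp
  show "card (roots_of_unity n :: 'a set) \<le> n"
    using card_poly_roots_bound[OF p] r deg by simp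
qed

context valued_field
begin

text \<open>A finite subset of E replaces the set of residue classes met by \<open>A\<close>, so
  that sums and products over the residue field can be formed in E.\<close>

definition transversal :: "'a set \<Rightarrow> 'a set \<Rightarrow> bool" where
  "transversal A R \<longleftrightarrow> finite R \<and> R \<subseteq> A \<and> (\<forall>x\<in>A. \<exists>r\<in>R. x - r \<in> P 1) \<and>
    (\<forall>r\<in>R. \<forall>s\<in>R. r - s \<in> P 1 \<longrightarrow> r = s)"

lemma transversalD:
  assumes "transversal A R"
  shows "finite R" "R \<subseteq> A" "x \<in> A \<Longrightarrow> \<exists>r\<in>R. x - r \<in> P 1"
    "r \<in> R \<Longrightarrow> s \<in> R \<Longrightarrow> r - s \<in> P 1 \<Longrightarrow> r = s"
  using assms by (auto simp: transversal_def)

lemma transversal_integers_exists: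
  assumes S: "subfield_set S" and fin: "finite (residue_field S v)"
  obtains R where "transversal (S \<inter> P 0) R" "card R = res_card S v"
proof -
  define cls where "cls x = {y \<in> S \<inter> P 0. x - y \<in> P 1}" for x
  have rf: "residue_field S v = cls ` (S \<inter> P 0)"
    unfolding residue_field_def cls_def val_ring_eq_vball val_ideal_eq_vball by simp
  have cls_eq: "cls x = cls y \<longleftrightarrow> x - y \<in> P 1" if "x \<in> S \<inter> P 0" "y \<in> S \<inter> P 0" for x y
  proof
    assume "cls x = cls y"
    moreover have "y \<in> cls y" using that by (simp add: cls_def)
    ultimately have "y \<in> cls x" by simp
    then show "x - y \<in> P 1" by (simp add: cls_def)
  next
    assume "x - y \<in> P 1"
    then show "cls x = cls y"
      unfolding cls_def using vball_trans[of x y 1] vball_trans[of y x 1] vball_diff_commute by blast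
  qed
  obtain R where R: "R \<subseteq> S \<inter> P 0" "inj_on cls R" "residue_field S v = cls ` R"
    using subset_image_inj[of "residue_field S v" cls "S \<inter> P 0"] rf by auto
  show ?thesis
  proof
    show "card R = res_card S v" using R by (simp add: res_card_def card_image)
    have "finite R" using fin R finite_imageD by metis
    moreover have "\<exists>r\<in>R. x - r \<in> P 1" if "x \<in> S \<inter> P 0" for x
    proof -
      have "cls x \<in> cls ` R" using R(3) rf that by auto
      then obtain r where "r \<in> R" "cls x = cls r" by auto
      then show ?thesis using cls_eq R(1) that by blast
    qed
    moreover have "r = s" if "r \<in> R" "s \<in> R" "r - s \<in> P 1" for r s
      using that R(1,2) cls_eq by (metis inj_onD subset_iff)
    ultimately show "transversal (S \<inter> P 0) R" using R(1) by (auto simp: transversal_def)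
  qed
qed

text \<open>Replaces reindexing over the residue field: a map that is injective modulo p induces, by
  finiteness, a permutation of the representatives.\<close>

lemma transversal_permutation:
  assumes T: "transversal A R"
    and ex: "\<And>r. r \<in> R \<Longrightarrow> \<exists>s\<in>R. f r - s \<in> P 1"
    and inj: "\<And>r s. r \<in> R \<Longrightarrow> s \<in> R \<Longrightarrow> f r - f s \<in> P 1 \<Longrightarrow> r - s \<in> P 1"
  shows "\<exists>\<sigma>. bij_betw \<sigma> R R \<and> (\<forall>r\<in>R. f r - \<sigma> r \<in> P 1)"
proof -
  note R = transversalD[OF T]
  obtain \<sigma> where \<sigma>: "\<And>r. r \<in> R \<Longrightarrow> \<sigma> r \<in> R \<and> f r - \<sigma> r \<in> P 1" using ex by metis
  have "inj_on \<sigma> R"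
  proof (rule inj_onI)
    fix r s assume rs: "r \<in> R" "s \<in> R" "\<sigma> r = \<sigma> s"
    then have "f r - f s \<in> P 1" using \<sigma> vball_trans vball_diff_commute by metis
    then show "r = s" using inj R(4) rs by blast
  qed
  moreover from this have "\<sigma> ` R = R" using \<sigma> R(1) by (intro endo_inj_surj) auto
  ultimately show ?thesis using \<sigma> by (auto simp: bij_betw_def)
qed

text \<open>Translation by 1 permutes the residue field. Comparing the sum of all its elements with
  the sum of the translates gives q = 0 there.\<close>

lemma of_nat_res_card:
  assumes S: "subfield_set S" and fin: "finite (residue_field S v)"
  shows "of_nat (res_card S v) \<in> P 1"
proof -
  interpret F: subfield_set S by fact
  obtain R where T: "transversal (S \<inter> P 0) R" "card R = res_card S v"
    using transversal_integers_exists[OF S fin] .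
  note R = transversalD[OF T(1)]
  have "\<exists>\<sigma>. bij_betw \<sigma> R R \<and> (\<forall>r\<in>R. (r + 1) - \<sigma> r \<in> P 1)"
  proof (rule transversal_permutation[OF T(1)])
    fix r assume "r \<in> R"
    then show "\<exists>s\<in>R. (r + 1) - s \<in> P 1" using R(2) by (intro R(3)) auto
  qed auto
  then obtain \<sigma> where \<sigma>: "bij_betw \<sigma> R R" "\<And>r. r \<in> R \<Longrightarrow> (r + 1) - \<sigma> r \<in> P 1" by auto
  have "(\<Sum>r\<in>R. (r + 1) - \<sigma> r) \<in> P 1" using \<sigma>(2) by auto
  also have "(\<Sum>r\<in>R. (r + 1) - \<sigma> r) = (\<Sum>r\<in>R. r) + of_nat (card R) - (\<Sum>r\<in>R. \<sigma> r)"
    by (simp add: sum_subtractf sum.distrib)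
  also have "(\<Sum>r\<in>R. \<sigma> r) = (\<Sum>r\<in>R. r)" using sum.reindex_bij_betw[OF \<sigma>(1), of "\<lambda>x. x"] by simp
  finally show ?thesis using T(2) by simp
qed

lemma transversal_units_exists:
  assumes S: "subfield_set S" and fin: "finite (residue_field S v)"
  obtains R where "transversal {x \<in> S. x \<noteq> 0 \<and> v x = 0} R" "card R = res_card S v - 1"
proof -
  interpret F: subfield_set S by fact
  obtain R where T: "transversal (S \<inter> P 0) R" "card R = res_card S v"
    using transversal_integers_exists[OF S fin] .
  note R = transversalD[OF T(1)]
  obtain z where z: "z \<in> R" "z \<in> P 1" using R(3)[of 0] vball_diff_commute[of 0 _ 1] by auto
  have z_unique: "r = z" if "r \<in> R" "r \<in> P 1" for r using R(4)[OF that(1) z(1)] that z by blast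
  show ?thesis
  proof
    show "card (R - {z}) = res_card S v - 1" using R(1) T(2) z by simp
    have "\<exists>r\<in>R - {z}. x - r \<in> P 1" if x: "x \<in> S" "x \<noteq> 0" "v x = 0" for x
    proof -
      obtain r where r: "r \<in> R" "x - r \<in> P 1" using R(3)[of x] x by (auto simp: vball_def)
      have "r \<noteq> z" using unit_cong[OF vball_diff_commute[OF r(2)]] x z(2) by (auto simp: vball_def)
      then show ?thesis using r by blast
    qed
    moreover have "R - {z} \<subseteq> {x \<in> S. x \<noteq> 0 \<and> v x = 0}" using R(2) z_unique unitD by blast
    ultimately show "transversal {x \<in> S. x \<noteq> 0 \<and> v x = 0} (R - {z})"
      using R(1,4) by (auto simp: transversal_def)
  qed
qed

text \<open>Multiplication by \<open>x\<close> permutes the nonzero residues. Comparing the products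
  before and after produces the factor x^(q-1), and the common product is a unit and
  cancels.\<close>

lemma unit_power_res_card:
  assumes S: "subfield_set S" and fin: "finite (residue_field S v)"
    and x: "x \<in> S" "x \<noteq> 0" "v x = 0"
  shows "x ^ (res_card S v - 1) - 1 \<in> P 1"
proof -
  interpret F: subfield_set S by fact
  obtain R where T: "transversal {x \<in> S. x \<noteq> 0 \<and> v x = 0} R" "card R = res_card S v - 1"
    using transversal_units_exists[OF S fin] .
  note R = transversalD[OF T(1)]
  have "\<exists>\<sigma>. bij_betw \<sigma> R R \<and> (\<forall>r\<in>R. x * r - \<sigma> r \<in> P 1)"
  proof (rule transversal_permutation[OF T(1)])
    fix r assume "r \<in> R"
    then show "\<exists>s\<in>R. x * r - s \<in> P 1" using R(2) x by (intro R(3)) (auto simp: v_mult)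
  next
    fix r s assume "x * r - x * s \<in> P 1"
    from cong_divide[OF this x(2,3)] show "r - s \<in> P 1" using x by simp
  qed
  then obtain \<sigma> where \<sigma>: "bij_betw \<sigma> R R" "\<And>r. r \<in> R \<Longrightarrow> x * r - \<sigma> r \<in> P 1" by auto
  have RP: "r \<in> P 0" if "r \<in> R" for r using that R(2) by (auto simp: vball_def)
  have \<sigma>R: "\<sigma> r \<in> R" if "r \<in> R" for r using \<sigma>(1) that by (auto simp: bij_betw_def)
  have "(\<Prod>r\<in>R. x * r) - (\<Prod>r\<in>R. \<sigma> r) \<in> P 1"
    using RP \<sigma>R \<sigma>(2) x by (intro cong_prod vball_mult_left) (auto simp: vball_def)
  also have "(\<Prod>r\<in>R. \<sigma> r) = \<Prod>R" using prod.reindex_bij_betw[OF \<sigma>(1), of "\<lambda>x. x"] by simp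
  also have "(\<Prod>r\<in>R. x * r) = x ^ card R * \<Prod>R" by (simp add: prod.distrib)
  finally have *: "x ^ card R * \<Prod>R - \<Prod>R \<in> P 1" .
  have "\<Prod>Q \<noteq> 0 \<and> v (\<Prod>Q) = 0" if "Q \<subseteq> R" for Q
    using finite_subset[OF that R(1)] that
  proof (induction Q rule: finite_induct)
    case (insert q Q)
    then show ?case using R(2) by (auto simp: v_mult)
  qed simp
  then have "\<Prod>R \<noteq> 0" "v (\<Prod>R) = 0" by auto
  from cong_divide[OF * this] show ?thesis using \<open>\<Prod>R \<noteq> 0\<close> T(2) by simp
qed

lemma res_card_ge_2:
  assumes S: "subfield_set S" and fin: "finite (residue_field S v)"
  shows "res_card S v \<ge> 2"
proof -
  interpret F: subfield_set S by fact
  obtain R where T: "transversal {x \<in> S. x \<noteq> 0 \<and> v x = 0} R" "card R = res_card S v - 1"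
    using transversal_units_exists[OF S fin] .
  note R = transversalD[OF T(1)]
  have "R \<noteq> {}" using R(3)[of 1] by auto
  then have "card R \<noteq> 0" using R(1) by auto
  then show ?thesis using T(2) by simp
qed

text \<open>As q lies in p, q - 1 is congruent to -1. This makes X^(q-1) - 1 separable modulo
  p.\<close>

lemma of_nat_res_card_minus_1:
  assumes S: "subfield_set S" and fin: "finite (residue_field S v)"
  shows "of_nat (res_card S v - 1) \<notin> P 1"
proof
  assume a: "of_nat (res_card S v - 1) \<in> P 1"
  have "(of_nat (res_card S v) :: 'a) = of_nat (res_card S v - 1) + 1"
    using res_card_ge_2[OF assms] by (cases "res_card S v") auto
  then have "1 = (of_nat (res_card S v) :: 'a) - of_nat (res_card S v - 1)" by simp
  then show False using vball_diff[OF of_nat_res_card[OF assms] a] by simp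
qed

lemma teichmuller:
  assumes S: "subfield_set S" "complete_on S v" and fin: "finite (residue_field S v)"
    and x: "x \<in> S" "x \<noteq> 0" "v x = 0"
  shows "\<exists>\<zeta>\<in>S \<inter> roots_of_unity (res_card S v - 1). \<zeta> - x \<in> P 1"
proof -
  interpret F: subfield_set S by fact
  show ?thesis
    using hensel_root[OF S of_nat_res_card_minus_1[OF S(1) fin] _ _ x
        unit_power_res_card[OF S(1) fin x]]
    by (auto simp: roots_of_unity_def)
qed

text \<open>Distinct unit classes have distinct Teichmueller representatives, which gives q - 1
  roots in \<open>S\<close>. A polynomial of degree q - 1 has no further roots anywhere in E, which
  forces all of them into \<open>S\<close>.\<close>

lemma card_roots_of_unity_res_card:
  assumes S: "subfield_set S" "complete_on S v" and fin: "finite (residue_field S v)"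
  shows "card (roots_of_unity (res_card S v - 1) :: 'a set) = res_card S v - 1"
    and "roots_of_unity (res_card S v - 1) \<subseteq> S"
proof -
  let ?\<mu> = "roots_of_unity (res_card S v - 1) :: 'a set"
  interpret F: subfield_set S by fact
  have pos: "res_card S v - 1 > 0" using res_card_ge_2[OF S(1) fin] by simp
  obtain R where T: "transversal {x \<in> S. x \<noteq> 0 \<and> v x = 0} R" "card R = res_card S v - 1"
    using transversal_units_exists[OF S(1) fin] .
  note R = transversalD[OF T(1)]
  have "\<forall>r\<in>R. \<exists>\<zeta>\<in>S \<inter> ?\<mu>. \<zeta> - r \<in> P 1" using teichmuller[OF S fin] R(2) by blast
  then obtain t where t: "\<And>r. r \<in> R \<Longrightarrow> t r \<in> S \<inter> ?\<mu> \<and> t r - r \<in> P 1" by metis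
  have "inj_on t R"
  proof (rule inj_onI)
    fix r s assume "r \<in> R" "s \<in> R" "t r = t s"
    then show "r = s" using t R(4) vball_trans vball_diff_commute by metis
  qed
  then have c: "card (t ` R) = res_card S v - 1" using T(2) card_image by metis
  have sub: "t ` R \<subseteq> S \<inter> ?\<mu>" using t by auto
  have finm: "finite ?\<mu>" using finite_roots_of_unity[OF pos] .
  have le: "card ?\<mu> \<le> card (t ` R)" using card_roots_of_unity_le[OF pos] c by simp
  have eq: "t ` R = ?\<mu>"
    using card_seteq[OF finm _ le] sub by blast
  then show "card ?\<mu> = res_card S v - 1" using c by simp
  show "?\<mu> \<subseteq> S" using eq sub by blast
qed

lemma root_of_unity_unit:
  assumes "x \<in> roots_of_unity n" "n > 0" shows "x \<noteq> 0" "v x = 0"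
proof -
  from assms have x: "x ^ n = 1" by (simp add: roots_of_unity_def)
  show "x \<noteq> 0" using x assms(2) by (auto simp: power_0_left)
  then show "v x = 0" using v_power[of x n] x assms(2) by simp
qed

end

section \<open>Cyclicity of groups of roots of unity\<close>

lemma power_eq_1_gcd:
  fixes x :: "'a::field"
  assumes "x ^ m = 1" "x ^ n = 1"
  shows "x ^ gcd m n = 1"
proof (cases "m = 0")
  case False
  obtain a b where ab: "m * a = n * b + gcd m n" using bezout_nat[OF False] by blast
  have "1 = x ^ (m * a)" using assms by (simp add: power_mult)
  also have "\<dots> = x ^ gcd m n" using assms by (simp add: ab power_add power_mult)
  finally show ?thesis by simp
qed (use assms in simp)

text \<open>Both inclusions of the image of the \<open>m\<close>-th power map are counted: its fibres have at most
  \<open>gcd N m\<close> elements, its image at most \<open>N div gcd N m\<close>.\<close>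

lemma roots_of_unity_power_image:
  assumes N: "N > 0" and card: "card (roots_of_unity N :: 'a::field set) = N"
  shows "(\<lambda>x. x ^ m) ` (roots_of_unity N :: 'a set) = roots_of_unity (N div gcd N m)"
proof -
  let ?A = "roots_of_unity N :: 'a set" and ?d = "gcd N m"
  let ?B = "roots_of_unity (N div ?d) :: 'a set"
  have d: "?d > 0" "N div ?d > 0" using N by (auto simp: div_greater_zero_iff)
  have finA: "finite ?A" and finB: "finite ?B" using finite_roots_of_unity N d by auto
  have sub: "(\<lambda>x. x ^ m) ` ?A \<subseteq> ?B"
  proof
    fix y assume "y \<in> (\<lambda>x. x ^ m) ` ?A"
    then obtain x where x: "x ^ N = 1" "y = x ^ m" by (auto simp: roots_of_unity_def)
    have "m * (N div ?d) = N * (m div ?d)" by (simp add: div_mult_swap mult.commute)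
    then have "y ^ (N div ?d) = (x ^ N) ^ (m div ?d)" using x(2) by (simp add: power_mult[symmetric])
    then show "y \<in> ?B" using x by (simp add: roots_of_unity_def)
  qed
  have fibre: "card {x \<in> ?A. x ^ m = y} \<le> ?d" for y
  proof (cases "\<exists>x0\<in>?A. x0 ^ m = y")
    case True
    then obtain x0 where x0: "x0 ^ N = 1" "x0 ^ m = y" by (auto simp: roots_of_unity_def)
    have nz: "x0 \<noteq> 0" using x0 N by (auto simp: power_0_left)
    \<comment> \<open>Dividing by one point \<open>x0\<close> embeds the fibre into the kernel,
      whose elements are killed by N and by m, hence by their gcd.\<close>
    have "(\<lambda>x. x / x0) ` {x \<in> ?A. x ^ m = y} \<subseteq> roots_of_unity ?d"
    proof
      fix z assume "z \<in> (\<lambda>x. x / x0) ` {x \<in> ?A. x ^ m = y}"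
      then obtain x where x: "x ^ N = 1" "x ^ m = y" "z = x / x0" by (auto simp: roots_of_unity_def)
      have "z ^ N = 1" using x(1) x0(1) by (simp add: x(3) power_divide)
      moreover have "z ^ m = 1" using x(2) x0(2) nz by (metis divide_self power_divide power_not_zero x(3))
      ultimately have "z ^ ?d = 1" by (rule power_eq_1_gcd)
      then show "z \<in> roots_of_unity ?d" by (simp add: roots_of_unity_def)
    qed
    moreover have "inj_on (\<lambda>x. x / x0) {x \<in> ?A. x ^ m = y}"
      by (rule inj_onI) (use nz in simp)
    ultimately have "card {x \<in> ?A. x ^ m = y} \<le> card (roots_of_unity ?d :: 'a set)"
      by (intro card_inj_on_le finite_roots_of_unity[OF d(1)])
    then show ?thesis using card_roots_of_unity_le[OF d(1), where 'a = 'a] by simp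
  next
    case False
    then have empty: "{x \<in> ?A. x ^ m = y} = {}" by auto
    show ?thesis unfolding empty by simp
  qed
  have "N = card (\<Union>y\<in>(\<lambda>x. x ^ m) ` ?A. {x \<in> ?A. x ^ m = y})"
    using card by (intro trans[OF card[symmetric]] arg_cong[of _ _ card]) auto
  also have "\<dots> \<le> (\<Sum>y\<in>(\<lambda>x. x ^ m) ` ?A. card {x \<in> ?A. x ^ m = y})"
    using finA by (intro card_UN_le) auto
  also have "\<dots> \<le> (\<Sum>y\<in>(\<lambda>x. x ^ m) ` ?A. ?d)" by (intro sum_mono fibre)
  finally have "N \<le> card ((\<lambda>x. x ^ m) ` ?A) * ?d" by simp
  then have "N div ?d \<le> card ((\<lambda>x. x ^ m) ` ?A)"
    using d by (metis div_le_mono div_mult_self_is_m)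
  then have "card ?B \<le> card ((\<lambda>x. x ^ m) ` ?A)"
    using card_roots_of_unity_le[OF d(2), where 'a = 'a] by simp
  then show ?thesis using card_seteq[OF finB sub] by blast
qed

definition has_order :: "'a::field \<Rightarrow> nat \<Rightarrow> bool" where
  "has_order x n \<longleftrightarrow> (\<forall>j. x ^ j = 1 \<longleftrightarrow> n dvd j)"

text \<open>Raising (x y)^j = 1 to the power b removes y and leaves x^(j b) = 1, so a divides j b
  and, by coprimality, j. The same holds with the roles exchanged.\<close>

lemma has_order_mult_coprime:
  assumes x: "has_order x a" and y: "has_order y b" and ab: "coprime a b"
  shows "has_order (x * y) (a * b)"
  unfolding has_order_def
proof (intro allI iffI)
  fix j assume j: "(x * y) ^ j = 1"
  have xa: "x ^ a = 1" and yb: "y ^ b = 1" using x y by (auto simp: has_order_def)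
  have "x ^ (j * b) = ((x * y) ^ j) ^ b / (y ^ b) ^ j"
    using yb power_mult[of y b j] by (simp add: power_mult[symmetric] power_mult_distrib mult.commute)
  then have "a dvd j * b" using x j yb by (simp add: has_order_def)
  moreover have "y ^ (j * a) = ((x * y) ^ j) ^ a / (x ^ a) ^ j"
    using xa power_mult[of x a j] by (simp add: power_mult[symmetric] power_mult_distrib mult.commute)
  then have "b dvd j * a" using y j xa by (simp add: has_order_def)
  ultimately show "a * b dvd j"
    using ab by (simp add: coprime_dvd_mult_left_iff coprime_commute divides_mult)
next
  fix j assume "a * b dvd j"
  then have "x ^ j = 1" "y ^ j = 1"
    using x y by (auto simp: has_order_def dest: dvd_mult_left dvd_mult_right)
  then show "(x * y) ^ j = 1" by (simp add: power_mult_distrib)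
qed

text \<open>At most N div p of the N roots of unity are killed by N div p, so some x is not. For a >
  0 its power with exponent N div p^a is killed by p^a but not by p^(a-1).\<close>

lemma has_order_prime_power_exists:
  assumes N: "N > 0" and card: "card (roots_of_unity N :: 'a::field set) = N"
    and p: "prime p" and dvd: "p ^ a dvd N"
  shows "\<exists>z::'a. has_order z (p ^ a)"
proof (cases "a = 0")
  case True
  then show ?thesis by (intro exI[of _ 1]) (auto simp: has_order_def)
next
  case False
  then have pN: "p dvd N" using dvd by (meson dvd_power dvd_trans gr0I)
  have lt: "N div p < N" "N div p > 0"
    using N pN prime_gt_1_nat[OF p] by (auto simp: dvd_imp_le div_greater_zero_iff)
  have "\<exists>x. x \<in> roots_of_unity N \<and> x ^ (N div p) \<noteq> (1::'a)"
  proof (rule ccontr)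
    assume "\<not> ?thesis"
    then have "roots_of_unity N \<subseteq> (roots_of_unity (N div p) :: 'a set)"
      by (auto simp: roots_of_unity_def)
    then have "N \<le> card (roots_of_unity (N div p) :: 'a set)"
      using card_mono[OF finite_roots_of_unity[OF lt(2)]] card by metis
    then show False using card_roots_of_unity_le[OF lt(2), where 'a = 'a] lt by simp
  qed
  then obtain x :: 'a where x: "x ^ N = 1" "x ^ (N div p) \<noteq> 1" by (auto simp: roots_of_unity_def)
  define z where "z = x ^ (N div p ^ a)"
  have z1: "z ^ (p ^ a) = 1" using x dvd by (simp add: z_def power_mult[symmetric])
  obtain c where c: "N = p ^ a * c" using dvd by auto
  obtain b where b: "a = Suc b" using False by (cases a) auto
  have pp: "p > 0" using p prime_gt_0_nat by blast
  have "N div p ^ a * p ^ b = N div p" using pp by (simp add: c b mult_ac)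
  then have z2: "z ^ (p ^ b) \<noteq> 1" using x by (simp add: z_def power_mult[symmetric])
  have "p ^ a dvd j" if "z ^ j = 1" for j
  proof -
    have g: "z ^ gcd (p ^ a) j = 1" using power_eq_1_gcd[OF z1 that] .
    obtain i where i: "i \<le> a" "gcd (p ^ a) j = p ^ i"
      using divides_primepow_nat[OF p, of "gcd (p ^ a) j" a] by auto
    have "i = a"
    proof (rule ccontr)
      assume "i \<noteq> a"
      then have "p ^ i dvd p ^ b" using i b by (intro le_imp_power_dvd) simp
      then have "z ^ (p ^ b) = 1" using g i(2) by (metis dvd_def power_mult power_one)
      with z2 show False by simp
    qed
    then show ?thesis using i(2) by (metis gcd_dvd2)
  qed
  moreover have "z ^ j = 1" if "p ^ a dvd j" for j
    using that z1 by (metis dvd_def power_mult power_one)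
  ultimately show ?thesis unfolding has_order_def by blast
qed

text \<open>The full p-part of m is split off for one prime p, and coprime orders multiply.\<close>

lemma has_order_exists:
  assumes N: "N > 0" and card: "card (roots_of_unity N :: 'a::field set) = N"
  shows "m dvd N \<Longrightarrow> \<exists>z::'a. has_order z m"
proof (induction m rule: less_induct)
  case (less m)
  have m: "m > 0" using less.prems N by (meson dvd_pos_nat)
  show ?case
  proof (cases "m = 1")
    case True
    then show ?thesis by (intro exI[of _ 1]) (simp add: has_order_def)
  next
    case False
    then obtain p where p: "prime p" "p dvd m" using prime_factor_nat by blast
    define a where "a = multiplicity p m"
    obtain m' where m': "m = p ^ a * m'" "\<not> p dvd m'"
      using multiplicity_decompose'[of m p] m p
      unfolding a_def by (metis gr0_conv_Suc nat.distinct(1) not_prime_unit)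
    have a: "a > 0" using p m by (simp add: a_def prime_multiplicity_gt_zero_iff)
    have cop: "coprime (p ^ a) m'" using p m'(2) by (simp add: prime_imp_coprime)
    have "p ^ a > 1" using a prime_gt_1_nat[OF p(1)] by (metis one_less_power)
    then have "m' < m" using m m'(1) by (cases "m' = 0") auto
    then obtain y :: 'a where y: "has_order y m'"
      using less.IH[of m'] less.prems m'(1) by (metis dvd_mult_right)
    obtain x :: 'a where x: "has_order x (p ^ a)"
      using has_order_prime_power_exists[OF N card p(1), of a] less.prems m'(1)
      by (metis dvd_mult_left)
    show ?thesis using has_order_mult_coprime[OF x y cop] m'(1) by auto
  qed
qed

text \<open>The powers of an element of order N are N distinct roots and so exhaust them. Such an
  element later generates the residue field of E.\<close>

lemma roots_of_unity_cyclic: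
  assumes N: "N > 0" and card: "card (roots_of_unity N :: 'a::field set) = N"
  shows "\<exists>\<zeta>::'a. \<zeta> ^ N = 1 \<and> (\<forall>x\<in>roots_of_unity N. \<exists>i. x = \<zeta> ^ i)"
proof -
  obtain \<zeta> :: 'a where z: "has_order \<zeta> N" using has_order_exists[OF N card dvd_refl] by blast
  have zN: "\<zeta> ^ N = 1" using z by (simp add: has_order_def)
  have nz: "\<zeta> \<noteq> 0" using zN N by (auto simp: power_0_left)
  have *: "i = j" if "\<zeta> ^ i = \<zeta> ^ j" "i \<le> j" "j < N" for i j
  proof -
    have "\<zeta> ^ (j - i) = 1" using that nz by (simp add: power_diff)
    then have "N dvd j - i" using z by (simp add: has_order_def)
    then show ?thesis using that dvd_imp_le[of N "j - i"] by (cases "i = j") auto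
  qed
  have "inj_on (\<lambda>i. \<zeta> ^ i) {..<N}"
  proof (rule inj_onI)
    fix i j assume "i \<in> {..<N}" "j \<in> {..<N}" "\<zeta> ^ i = \<zeta> ^ j"
    then show "i = j" using *[of i j] *[of j i] by (cases "i \<le> j") auto
  qed
  then have c: "card ((\<lambda>i. \<zeta> ^ i) ` {..<N}) = N" by (simp add: card_image)
  have "(\<lambda>i. \<zeta> ^ i) ` {..<N} \<subseteq> roots_of_unity N"
    using zN by (auto simp: roots_of_unity_def power_mult[symmetric] mult.commute[of _ N])
      (simp add: power_mult)
  then have "(\<lambda>i. \<zeta> ^ i) ` {..<N} = roots_of_unity N"
    using card_seteq[OF finite_roots_of_unity[OF N]] c card by (metis order_refl)
  then show ?thesis using zN by blast
qed

section \<open>The tame class\<close>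

locale tame_extension =
  fixes k :: "'a::field set" and v :: "'a \<Rightarrow> int"
  assumes E: "nonarch_local_field v" and k: "nonarch_local_subfield k v"
    and fin_ext: "finite_ext k UNIV" and tame: "tamely_ramified v UNIV k"

sublocale tame_extension \<subseteq> valued_subfield v k
  using E k
  by unfold_locales (auto simp: nonarch_local_field_def nonarch_local_subfield_def)

context tame_extension
begin

text \<open>As \<open>v\<close> is normalized on E, the ramification index is the value of a
  uniformizer of k. The abbreviations \<open>N\<close> and \<open>M\<close> stand for q_E - 1 and q
  - 1.\<close>

abbreviation e :: nat where "e \<equiv> vmin k v"
abbreviation N :: nat where "N \<equiv> res_card UNIV v - 1"
abbreviation M :: nat where "M \<equiv> res_card k v - 1"
abbreviation \<mu> :: "'a set" where "\<mu> \<equiv> roots_of_unity N"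
abbreviation et :: nat where "et \<equiv> e_tilde k v"

lemma subfield_UNIV: "subfield_set (UNIV :: 'a set)"
  by (rule subfield_setI[OF is_subfield_UNIV])

lemma subfield_k: "subfield_set k"
  by unfold_locales

lemma complete_E: "complete_on UNIV v" and finite_residue_E: "finite (residue_field UNIV v)"
  using E by (auto simp: nonarch_local_field_def)

lemma complete_k: "complete_on k v" and finite_residue_k: "finite (residue_field k v)"
  using k by (auto simp: nonarch_local_subfield_def)

lemma ram_index_UNIV: "ram_index v UNIV k = e"
  by (simp add: ram_index_def vmin_UNIV)

lemma N_pos: "N > 0" and M_pos: "M > 0"
  using res_card_ge_2[OF subfield_UNIV finite_residue_E] res_card_ge_2[OF subfield_k finite_residue_k]
  by auto

lemma of_nat_N: "of_nat N \<notin> P 1" and of_nat_M: "of_nat M \<notin> P 1"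
  using of_nat_res_card_minus_1[OF subfield_UNIV finite_residue_E]
    of_nat_res_card_minus_1[OF subfield_k finite_residue_k] by auto

text \<open>Tameness enters here: e is a unit, so X^e - w is separable modulo p for a 1-unit w. That
  \<open>residue_char v\<close> is attained comes from q lying in p.\<close>

lemma of_nat_e: "of_nat e \<notin> P 1"
proof (rule of_nat_unit_if_not_residue_char_dvd)
  show "\<not> residue_char v dvd e" using tame by (simp add: tamely_ramified_def ram_index_UNIV)
  show "\<exists>p>0. of_nat p \<in> P 1"
    using of_nat_res_card[OF subfield_k finite_residue_k] M_pos
    by (intro exI[of _ "res_card k v"]) auto
qed

lemma card_mu: "card \<mu> = N"
  using card_roots_of_unity_res_card(1)[OF subfield_UNIV complete_E finite_residue_E] .

lemma card_mu_k: "card (roots_of_unity M :: 'a set) = M" and mu_k_subset: "roots_of_unity M \<subseteq> k"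
  using card_roots_of_unity_res_card[OF subfield_k complete_k finite_residue_k] by auto

lemma mu_unit: "x \<in> \<mu> \<Longrightarrow> x \<noteq> 0" "x \<in> \<mu> \<Longrightarrow> v x = 0"
  using root_of_unity_unit[OF _ N_pos] by auto

lemma mu_mult: "x \<in> \<mu> \<Longrightarrow> y \<in> \<mu> \<Longrightarrow> x * y \<in> \<mu>"
  and mu_divide: "x \<in> \<mu> \<Longrightarrow> y \<in> \<mu> \<Longrightarrow> x / y \<in> \<mu>"
  by (auto simp: roots_of_unity_def power_mult_distrib power_divide)

lemma mu_power: "x \<in> \<mu> \<Longrightarrow> x ^ n \<in> \<mu>"
  by (auto simp: roots_of_unity_def power_mult[symmetric] mult.commute[of n])
    (simp add: power_mult)

lemma mu_cong_eq:
  assumes "x \<in> \<mu>" "y \<in> \<mu>" "x - y \<in> P 1" shows "x = y"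
proof -
  have "x / y - 1 \<in> P 1"
    using cong_divide[OF assms(3) mu_unit[OF assms(2)]] mu_unit(1)[OF assms(2)] by simp
  moreover have "(x / y) ^ N = 1" using mu_divide[OF assms(1,2)] by (simp add: roots_of_unity_def)
  ultimately have "x / y = 1" using root_unity_cong_one[OF of_nat_N] by blast
  then show ?thesis using mu_unit(1)[OF assms(2)] by simp
qed

lemma teichmuller_E: "x \<noteq> 0 \<Longrightarrow> v x = 0 \<Longrightarrow> \<exists>\<zeta>\<in>\<mu>. x - \<zeta> \<in> P 1"
  using teichmuller[OF subfield_UNIV complete_E finite_residue_E] vball_diff_commute by blast

lemma teichmuller_k: "x \<in> k \<Longrightarrow> x \<noteq> 0 \<Longrightarrow> v x = 0 \<Longrightarrow> \<exists>\<zeta>\<in>roots_of_unity M. x - \<zeta> \<in> P 1"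
  using teichmuller[OF subfield_k complete_k finite_residue_k] vball_diff_commute by blast

text \<open>Since M dividing N is only deduced from this inclusion, the argument goes through
  residues: c^N is congruent to 1 and an M-th root of unity, hence equal to 1.\<close>

lemma mu_k_subset_mu: "roots_of_unity M \<subseteq> \<mu>"
proof
  fix c :: 'a assume c: "c \<in> roots_of_unity M"
  note u = root_of_unity_unit[OF c M_pos]
  have "c ^ N - 1 \<in> P 1" using unit_power_res_card[OF subfield_UNIV finite_residue_E _ u] by simp
  moreover have "(c ^ N) ^ M = 1"
  proof -
    have "c ^ M = 1" using c by (simp add: roots_of_unity_def)
    then show ?thesis by (metis power_mult mult.commute power_one)
  qed
  ultimately show "c \<in> \<mu>" using root_unity_cong_one[OF of_nat_M] by (auto simp: roots_of_unity_def)
qed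

text \<open>All M roots of unity in k are killed by \<open>gcd M N\<close>, and at most
  \<open>gcd M N\<close> elements are.\<close>

lemma M_dvd_N: "M dvd N"
proof -
  have g: "gcd M N > 0" using M_pos by simp
  have "roots_of_unity M \<subseteq> (roots_of_unity (gcd M N) :: 'a set)"
    using mu_k_subset_mu power_eq_1_gcd by (auto simp: roots_of_unity_def)
  then have "M \<le> card (roots_of_unity (gcd M N) :: 'a set)"
    using card_mono[OF finite_roots_of_unity[OF g]] card_mu_k by metis
  then have "M \<le> gcd M N" using card_roots_of_unity_le[OF g, where 'a = 'a] by simp
  then show ?thesis using M_pos by (metis gcd_dvd2 gcd_le1_nat le_antisym less_numeral_extra(3))
qed

lemma et_eq: "et = gcd (N div M) e"
  by (simp add: e_tilde_def ram_index_UNIV)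

lemma et_dvd: "et dvd N div M" "et dvd e" "et dvd N"
  unfolding et_eq using M_dvd_N by (auto intro: dvd_trans[OF gcd_dvd1] simp: div_dvd_iff_mult)

lemma e_root_of_one_unit: "w - 1 \<in> P 1 \<Longrightarrow> \<exists>x. x ^ e = w \<and> x - 1 \<in> P 1"
proof -
  assume w: "w - 1 \<in> P 1"
  have "w \<in> P 0" using unit_cong[OF w] by (simp add: vball_def)
  then show ?thesis
    using hensel_root[OF subfield_UNIV complete_E of_nat_e, of w 1] vball_diff_commute[OF w] by auto
qed

text \<open>In the cyclic group of order N, the kernel of the exponent N div et consists of the
  et-th powers. By Bezout these are the products of an e-th power and an (N div M)-th power, and the
  latter are M-th roots of unity.\<close>

lemma kernel_iff_product:
  assumes "x \<in> \<mu>"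
  shows "x ^ (N div et) = 1 \<longleftrightarrow> (\<exists>a\<in>\<mu>. \<exists>c\<in>roots_of_unity M. x = a ^ e * c)"
proof
  assume "x ^ (N div et) = 1"
  moreover have "gcd N et = et" using et_dvd(3) by (simp add: gcd_proj2_iff)
  ultimately obtain a where a: "a \<in> \<mu>" "x = a ^ et"
    using roots_of_unity_power_image[OF N_pos card_mu, of et] by (force simp: roots_of_unity_def)
  have "N div M \<noteq> 0" using M_dvd_N N_pos by (metis dvd_div_eq_0_iff less_numeral_extra(3))
  \<comment> \<open>In the natural-number form of Bezout the term e t stands beside the gcd, so the
    e-th power below is taken of 1 / a^t.\<close>
  then obtain s t where st: "N div M * s = e * t + et"
    using bezout_nat[of "N div M" e] et_eq by auto
  have a0: "a \<noteq> 0" using mu_unit a by auto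
  show "\<exists>a\<in>\<mu>. \<exists>c\<in>roots_of_unity M. x = a ^ e * c"
  proof (intro bexI)
    have "a ^ (N div M * s) = a ^ (e * t) * a ^ et" by (simp only: st power_add)
    then show "x = (1 / a ^ t) ^ e * a ^ (N div M * s)"
      using a a0 by (simp add: power_divide power_mult[symmetric] mult.commute[of t])
    show "1 / a ^ t \<in> \<mu>" using a mu_power[OF a(1)] mu_divide[of 1 "a ^ t"]
      by (simp add: roots_of_unity_def)
    have "(a ^ (N div M * s)) ^ M = (a ^ N) ^ s"
      unfolding power_mult[symmetric] using M_dvd_N by (simp add: mult_ac)
    then show "a ^ (N div M * s) \<in> roots_of_unity M" using a by (simp add: roots_of_unity_def)
  qed
next
  assume "\<exists>a\<in>\<mu>. \<exists>c\<in>roots_of_unity M. x = a ^ e * c"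
  then obtain a c where ac: "a ^ N = 1" "c ^ M = 1" "x = a ^ e * c"
    by (auto simp: roots_of_unity_def)
  have "e * (N div et) = N * (e div et)" using et_dvd by (simp add: div_mult_swap mult.commute)
  then have 1: "(a ^ e) ^ (N div et) = 1" using ac(1) by (metis power_mult power_one)
  have "N div et = M * (N div M div et)"
    using et_dvd(1) M_dvd_N by (simp add: div_mult_swap)
  then have "c ^ (N div et) = 1" using ac(2) by (metis power_mult power_one)
  with 1 show "x ^ (N div et) = 1" by (simp add: ac(3) power_mult_distrib)
qed

text \<open>The root \<open>\<zeta>\<close> represents \<open>\<pi>^e / \<pi>k\<close>. Another
  uniformizer of E contributes an e-th power, another element of k of the same valuation a unit of
  k. Reduced modulo p these become a^e and an M-th root of unity, the shape described by
  \<open>kernel_iff_product\<close>.\<close>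

lemma mu_tame_iff_sim:
  assumes \<pi>: "uniformizer v \<pi>" and \<pi>k: "uniformizer_sub k v \<pi>k"
    and \<zeta>: "\<zeta> \<in> \<mu>" "\<pi> ^ e / \<pi>k - \<zeta> \<in> P 1" and x: "x \<in> \<mu>"
  shows "x \<in> mu_tame k v \<longleftrightarrow> sim_rel k v x \<zeta>"
proof -
  have \<pi>': "\<pi> \<noteq> 0" "v \<pi> = 1" using \<pi> by (auto simp: uniformizer_def)
  have \<pi>k': "\<pi>k \<in> k" "\<pi>k \<noteq> 0" "v \<pi>k = int e" using \<pi>k by (auto simp: uniformizer_sub_def)
  note x' = mu_unit[OF x] and \<zeta>' = mu_unit[OF \<zeta>(1)]
  show ?thesis unfolding sim_rel_def kernel_iff_product[OF mu_divide[OF x \<zeta>(1)]]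
  proof
    assume "x \<in> mu_tame k v"
    then obtain \<rho> where \<rho>: "\<rho> \<noteq> 0" "v \<rho> = 1" "\<rho> ^ e / x \<in> k"
      by (auto simp: mu_tame_def uniformizer_def ram_index_UNIV divide_inverse)
    define c0 where "c0 = \<rho> ^ e / x / \<pi>k"
    have c0: "c0 \<in> k" "c0 \<noteq> 0" "v c0 = 0"
      using \<rho> \<pi>k' x' divide_mem[OF \<rho>(3) \<pi>k'(1)] by (auto simp: c0_def v_mult v_divide v_power)
    define u where "u = \<rho> / \<pi>"
    have u: "u \<noteq> 0" "v u = 0" using \<rho> \<pi>' by (auto simp: u_def v_divide)
    obtain a where a: "a \<in> \<mu>" "u - a \<in> P 1" using teichmuller_E u by blast
    obtain c where c: "c \<in> roots_of_unity M" "c0 - c \<in> P 1" using teichmuller_k c0 by blast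
    have c': "c \<in> \<mu>" using c mu_k_subset_mu by auto
    note a' = mu_unit[OF a(1)] and c'' = mu_unit[OF c']
    \<comment> \<open>Both sides are \<open>\<rho>^e / \<pi>k\<close>. Replacing each unit by its
      root of unity gives a congruence inside \<open>\<mu>\<close>, where congruence is
      equality.\<close>
    have eq: "u ^ e * (\<pi> ^ e / \<pi>k) = x * c0"
      using \<pi>' \<pi>k' x' by (simp add: u_def c0_def power_divide)
    have "u ^ e - a ^ e \<in> P 1" using cong_power[OF a(2)] u a' by (simp add: vball_def)
    then have "u ^ e * (\<pi> ^ e / \<pi>k) - a ^ e * \<zeta> \<in> P 1"
      using \<zeta> \<zeta>' u by (intro cong_mult) (auto simp: vball_def v_power)
    moreover have "x * c0 - x * c \<in> P 1"
      using c(2) x' c'' by (intro cong_mult) (auto simp: vball_def)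
    ultimately have "a ^ e * \<zeta> - x * c \<in> P 1"
      unfolding eq by (rule vball_trans[OF vball_diff_commute])
    then have "a ^ e * \<zeta> = x * c"
      by (rule mu_cong_eq[OF mu_mult[OF mu_power[OF a(1)] \<zeta>(1)] mu_mult[OF x c']])
    then have "x / \<zeta> = a ^ e * (1 / c)" using \<zeta>' c'' by (simp add: field_simps)
    moreover have "1 / c \<in> roots_of_unity M"
      using c(1) by (simp add: roots_of_unity_def power_divide)
    ultimately show "\<exists>a\<in>\<mu>. \<exists>c\<in>roots_of_unity M. x / \<zeta> = a ^ e * c" using a(1) by blast
  next
    assume "\<exists>a\<in>\<mu>. \<exists>c\<in>roots_of_unity M. x / \<zeta> = a ^ e * c"
    then obtain a c where ac: "a \<in> \<mu>" "c \<in> roots_of_unity M" "x / \<zeta> = a ^ e * c" by blast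
    note a' = mu_unit[OF ac(1)] and c' = root_of_unity_unit[OF ac(2) M_pos]
    have "\<pi> ^ e / \<pi>k / \<zeta> - 1 \<in> P 1" using cong_divide[OF \<zeta>(2) \<zeta>'] \<zeta>' by simp
    then obtain w where w: "w ^ e = \<pi> ^ e / \<pi>k / \<zeta>" "w - 1 \<in> P 1" using e_root_of_one_unit by blast
    have w': "w \<noteq> 0" "v w = 0" using unit_cong[OF w(2)] by auto
    \<comment> \<open>Division by \<open>w\<close> turns \<open>\<pi>^e\<close> into exactly
      \<open>\<pi>k * \<zeta>\<close>; the factor \<open>a\<close> changes this to
      \<open>\<pi>k * x / c\<close>, so that \<open>\<rho>^e / x\<close> lies in k.\<close>
    define \<rho> where "\<rho> = \<pi> * a / w"
    have \<rho>: "uniformizer v \<rho>"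
      using \<pi>' a' w' by (simp add: \<rho>_def uniformizer_def v_mult v_divide)
    have xeq: "x = a ^ e * c * \<zeta>" using ac(3) \<zeta>' by (simp add: field_simps)
    have "\<rho> ^ e / x = \<pi>k / c"
      using w(1) \<pi>' \<pi>k' \<zeta>' a' c' by (simp add: \<rho>_def power_divide power_mult_distrib xeq)
    moreover have "\<pi>k / c \<in> k" using \<pi>k' ac(2) mu_k_subset by auto
    moreover have "\<pi>k / c \<in> P 0" using \<pi>k' c' by (simp add: vball_def v_divide)
    ultimately show "x \<in> mu_tame k v"
      using x \<rho> by (auto simp: mu_tame_def ram_index_UNIV divide_inverse val_ring_eq_vball)
  qed
qed

lemma uniformizer_quotient_unit:
  assumes "uniformizer v \<pi>" and "uniformizer_sub k v \<pi>k"
  shows "\<pi> ^ e / \<pi>k \<noteq> 0" "v (\<pi> ^ e / \<pi>k) = 0"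
  using assms by (auto simp: uniformizer_def uniformizer_sub_def v_divide v_power)

lemma mu_tame_class:
  "\<exists>x\<in>\<mu>. x \<in> mu_tame k v \<and> mu_tame k v = {y \<in> \<mu>. sim_rel k v y x}"
proof -
  obtain \<pi> \<pi>k where p: "uniformizer v \<pi>" "uniformizer_sub k v \<pi>k"
    using uniformizer_exists uniformizer_sub_exists by blast
  obtain \<zeta> where z: "\<zeta> \<in> \<mu>" "\<pi> ^ e / \<pi>k - \<zeta> \<in> P 1"
    using teichmuller_E[OF uniformizer_quotient_unit[OF p]] by blast
  note iff = mu_tame_iff_sim[OF p z]
  have "mu_tame k v = {y \<in> \<mu>. sim_rel k v y \<zeta>}"
    using iff by (auto simp: mu_tame_def)
  moreover have "sim_rel k v \<zeta> \<zeta>" using mu_unit(1)[OF z(1)] by (simp add: sim_rel_def)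
  ultimately show ?thesis using z by auto
qed

text \<open>The equation \<zeta>^(N div et) = 1 holds between elements of \<open>\<mu>\<close>, so
  it can be tested modulo p, where \<open>\<zeta>\<close> may be replaced by
  \<open>\<pi>^e / \<pi>k\<close>. The pair of uniformizers is arbitrary, which identifies the
  existential with the universal condition.\<close>

lemma one_mem_mu_tame_iff:
  assumes p: "uniformizer v \<pi>" "uniformizer_sub k v \<pi>k"
  shows "1 \<in> mu_tame k v \<longleftrightarrow> (\<pi> ^ e / \<pi>k) ^ (N div et) - 1 \<in> P 1"
proof -
  let ?n = "N div et"
  note u = uniformizer_quotient_unit[OF p]
  obtain \<zeta> where z: "\<zeta> \<in> \<mu>" "\<pi> ^ e / \<pi>k - \<zeta> \<in> P 1" using teichmuller_E[OF u] by blast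
  note \<zeta>' = mu_unit[OF z(1)]
  have one: "1 \<in> \<mu>" by (simp add: roots_of_unity_def)
  have "1 \<in> mu_tame k v \<longleftrightarrow> \<zeta> ^ ?n = 1"
    unfolding mu_tame_iff_sim[OF p z one] using \<zeta>' by (auto simp: sim_rel_def power_divide)
  also have "\<dots> \<longleftrightarrow> \<zeta> ^ ?n - 1 \<in> P 1"
    using mu_cong_eq[OF mu_power[OF z(1)] one] by auto
  also have "\<dots> \<longleftrightarrow> (\<pi> ^ e / \<pi>k) ^ ?n - 1 \<in> P 1"
  proof -
    have "(\<pi> ^ e / \<pi>k) ^ ?n - \<zeta> ^ ?n \<in> P 1"
      using u \<zeta>' by (intro cong_power[OF z(2)]) (auto simp: vball_def)
    then show ?thesis using vball_trans vball_diff_commute by blast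
  qed
  finally show ?thesis .
qed

text \<open>The valuation e of y^e forces v y = 1, so an e-th root of a uniformizer of k is itself a
  uniformizer of E.\<close>

lemma e_root_iff_one_mem_mu_tame:
  "(\<exists>y \<pi>k. uniformizer_sub k v \<pi>k \<and> y ^ e = \<pi>k) \<longleftrightarrow> 1 \<in> mu_tame k v"
proof
  assume "\<exists>y \<pi>k. uniformizer_sub k v \<pi>k \<and> y ^ e = \<pi>k"
  then obtain y where y: "y ^ e \<in> k" "y ^ e \<noteq> 0" "v (y ^ e) = int e"
    by (auto simp: uniformizer_sub_def)
  have "y \<noteq> 0" using y(2) vmin_pos by (auto simp: power_0_left)
  moreover from this have "v y = 1" using y(3) vmin_pos by (simp add: v_power)
  ultimately show "1 \<in> mu_tame k v"
    using y by (auto simp: mu_tame_def ram_index_UNIV roots_of_unity_def uniformizer_def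
        val_ring_eq_vball vball_def)
next
  assume "1 \<in> mu_tame k v"
  then obtain \<pi> where "uniformizer v \<pi>" "\<pi> ^ e \<in> k"
    by (auto simp: mu_tame_def ram_index_UNIV)
  then show "\<exists>y \<pi>k. uniformizer_sub k v \<pi>k \<and> y ^ e = \<pi>k"
    by (auto simp: uniformizer_def uniformizer_sub_def v_power)
qed

end

section \<open>Linear algebra over a subfield\<close>

context subfield_set
begin

text \<open>Gaussian elimination: the equation \<open>i0\<close> is solved for a variable
  \<open>j0\<close> and substituted into the others. All coefficients stay in the subfield, so the
  nonzero solution is found there.\<close>

lemma homogeneous_system:
  assumes "finite I" "finite J" "card I < card J" "\<And>i j. i \<in> I \<Longrightarrow> j \<in> J \<Longrightarrow> A i j \<in> S"
  shows "\<exists>x. (\<forall>j\<in>J. x j \<in> S) \<and> (\<exists>j\<in>J. x j \<noteq> 0) \<and> (\<forall>i\<in>I. (\<Sum>j\<in>J. A i j * x j) = 0)"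
  using assms
proof (induction I arbitrary: J A rule: finite_induct)
  case empty
  then have "J \<noteq> {}" by auto
  then show ?case by (intro exI[of _ "\<lambda>_. 1"]) auto
next
  case (insert i0 I)
  show ?case
  proof (cases "\<forall>j\<in>J. A i0 j = 0")
    case True
    have "card I < card J" using insert by simp
    then obtain x where "\<forall>j\<in>J. x j \<in> S" "\<exists>j\<in>J. x j \<noteq> 0" "\<forall>i\<in>I. (\<Sum>j\<in>J. A i j * x j) = 0"
      using insert.IH[of J A] insert.prems by auto
    then show ?thesis using True by (intro exI[of _ x]) auto
  next
    case False
    then obtain j0 where j0: "j0 \<in> J" "A i0 j0 \<noteq> 0" by auto
    let ?J = "J - {j0}"
    define A' where "A' i j = A i j - A i j0 * A i0 j / A i0 j0" for i j
    have "card I < card ?J" using insert j0 by simp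
    moreover have "A' i j \<in> S" if "i \<in> I" "j \<in> ?J" for i j
      unfolding A'_def using insert.prems(3) that j0 by (intro diff_mem divide_mem mult_mem) auto
    ultimately obtain x where x: "\<forall>j\<in>?J. x j \<in> S" "\<exists>j\<in>?J. x j \<noteq> 0"
      "\<forall>i\<in>I. (\<Sum>j\<in>?J. A' i j * x j) = 0"
      using insert.IH[of ?J A'] insert.prems(1) by auto
    define s where "s i = (\<Sum>j\<in>?J. A i j * x j)" for i
    define y where "y = x(j0 := - s i0 / A i0 j0)"
    have sum_y: "(\<Sum>j\<in>J. A i j * y j) = A i j0 * (- s i0 / A i0 j0) + s i" for i
    proof -
      have "(\<Sum>j\<in>J. A i j * y j) = A i j0 * y j0 + (\<Sum>j\<in>?J. A i j * y j)"
        using insert.prems(1) j0 by (simp add: sum.remove)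
      also have "(\<Sum>j\<in>?J. A i j * y j) = s i"
        unfolding s_def by (intro sum.cong) (auto simp: y_def)
      finally show ?thesis by (simp add: y_def)
    qed
    have "s i0 \<in> S" unfolding s_def using insert.prems(3) x by (intro sum_mem mult_mem) auto
    then have "y j \<in> S" if "j \<in> J" for j
      using x that j0 insert.prems(3)[of i0 j0] by (auto simp: y_def)
    moreover have "\<exists>j\<in>J. y j \<noteq> 0" using x(2) by (auto simp: y_def)
    moreover have "(\<Sum>j\<in>J. A i j * y j) = 0" if "i \<in> insert i0 I" for i
    proof (cases "i = i0")
      case True
      then show ?thesis using j0 by (simp add: sum_y)
    next
      case False
      have "(\<Sum>j\<in>?J. A' i j * x j) = s i - A i j0 / A i0 j0 * s i0"
        unfolding s_def A'_def
        by (simp add: algebra_simps sum_subtractf sum_distrib_left)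
      then show ?thesis using x(3) that False by (simp add: sum_y)
    qed
    ultimately show ?thesis by blast
  qed
qed

text \<open>A sum over an infinite set is 0 by convention, so constant coefficients 1 would be a
  nontrivial relation.\<close>

lemma lin_indep_imp_finite: "lin_indep_over S A \<Longrightarrow> finite A"
proof (rule ccontr)
  assume A: "lin_indep_over S A" "infinite A"
  then obtain a where "a \<in> A" by fastforce
  with A show False
    unfolding lin_indep_over_def by (auto dest!: spec[of _ "\<lambda>_. 1"])
qed

lemma card_lin_indep_le:
  assumes A: "lin_indep_over S A" "A \<subseteq> L" and B: "finite B" "spans_over S B L"
  shows "card A \<le> card B"
proof (rule ccontr)
  assume "\<not> card A \<le> card B"
  then have lt: "card B < card A" by simp
  have finA: "finite A" by (rule lin_indep_imp_finite[OF A(1)])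
  have "\<forall>a\<in>A. \<exists>c. (\<forall>b\<in>B. c b \<in> S) \<and> a = (\<Sum>b\<in>B. c b * b)"
    using A(2) B(2) by (auto simp: spans_over_def)
  then obtain C where C: "\<And>a b. a \<in> A \<Longrightarrow> b \<in> B \<Longrightarrow> C a b \<in> S"
    "\<And>a. a \<in> A \<Longrightarrow> a = (\<Sum>b\<in>B. C a b * b)" by metis
  obtain x where x: "\<forall>a\<in>A. x a \<in> S" "\<exists>a\<in>A. x a \<noteq> 0" "\<forall>b\<in>B. (\<Sum>a\<in>A. C a b * x a) = 0"
    using homogeneous_system[OF B(1) finA lt, of "\<lambda>b a. C a b"] C(1) by auto
  have "(\<Sum>a\<in>A. x a * a) = (\<Sum>a\<in>A. x a * (\<Sum>b\<in>B. C a b * b))"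
    using C(2) by (intro sum.cong) auto
  also have "\<dots> = (\<Sum>b\<in>B. (\<Sum>a\<in>A. C a b * x a) * b)"
    unfolding sum_distrib_left sum_distrib_right
    by (subst sum.swap) (intro sum.cong refl, simp add: mult_ac)
  also have "\<dots> = 0" using x(3) by simp
  finally show False using A(1) x(1,2) unfolding lin_indep_over_def by blast
qed

text \<open>Frees \<open>degree\<close> from the basis picked by \<open>SOME\<close>.\<close>

lemma degree_eq_card:
  assumes "basis_over S L B"
  shows "Defs.degree S L = card B"
proof -
  define B' where "B' = (SOME B. basis_over S L B)"
  have "basis_over S L B'" unfolding B'_def using assms by (rule someI)
  then have "card B' = card B"
    using assms card_lin_indep_le[of B' L B] card_lin_indep_le[of B L B']
    by (auto simp: basis_over_def)
  then show ?thesis by (simp add: Defs.degree_def B'_def)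
qed

lemma lin_indep_insert:
  assumes A: "lin_indep_over S A" and x: "\<not> (\<exists>c. (\<forall>b\<in>A. c b \<in> S) \<and> x = (\<Sum>b\<in>A. c b * b))"
  shows "x \<notin> A" "lin_indep_over S (insert x A)"
proof -
  have fin: "finite A" by (rule lin_indep_imp_finite[OF A])
  show xA: "x \<notin> A"
  proof
    assume a: "x \<in> A"
    have "x = (\<Sum>b\<in>A. (if b = x then 1 else 0) * b)"
    proof -
      have "(\<Sum>b\<in>A. (if b = x then 1 else 0) * b) = (\<Sum>b\<in>A. if b = x then b else 0)"
        by (intro sum.cong) auto
      then show ?thesis using a fin by simp
    qed
    moreover have "\<forall>b\<in>A. (if b = x then 1 else 0) \<in> S" by simp
    ultimately have "\<exists>c. (\<forall>b\<in>A. c b \<in> S) \<and> x = (\<Sum>b\<in>A. c b * b)"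
      by (intro exI[of _ "\<lambda>b. if b = x then 1 else 0"]) (rule conjI)
    then show False using x by contradiction
  qed
  show "lin_indep_over S (insert x A)"
    unfolding lin_indep_over_def
  proof (intro allI impI)
    fix c assume c: "\<forall>b\<in>insert x A. c b \<in> S" and s: "(\<Sum>b\<in>insert x A. c b * b) = 0"
    have s': "c x * x + (\<Sum>b\<in>A. c b * b) = 0" using s xA fin by simp
    have cx: "c x = 0"
    proof (rule ccontr)
      assume nz: "c x \<noteq> 0"
      have "c x * x = - (\<Sum>b\<in>A. c b * b)" using s' by (simp add: eq_neg_iff_add_eq_0)
      then have "x = - (\<Sum>b\<in>A. c b * b) / c x" using nz by (metis nonzero_mult_div_cancel_left)
      also have "\<dots> = (\<Sum>b\<in>A. (- c b / c x) * b)"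
        by (simp add: sum_divide_distrib sum_negf[symmetric])
      finally have 1: "x = (\<Sum>b\<in>A. (- c b / c x) * b)" .
      have 2: "\<forall>b\<in>A. - c b / c x \<in> S" using c by auto
      from x show False by (rule notE) (rule exI conjI 1 2)+
    qed
    then have "(\<Sum>b\<in>A. c b * b) = 0" using s' by simp
    then have "\<forall>b\<in>A. c b = 0" using A c unfolding lin_indep_over_def by blast
    with cx show "\<forall>b\<in>insert x A. c b = 0" by simp
  qed
qed

lemma lin_indep_card_eq_imp_spans:
  assumes A: "lin_indep_over S A" "A \<subseteq> L" and B: "finite B" "spans_over S B L"
    and card: "card B \<le> card A"
  shows "spans_over S A L"
  unfolding spans_over_def
proof (rule ballI, rule ccontr)
  fix x assume xL: "x \<in> L" and x: "\<not> (\<exists>c. (\<forall>b\<in>A. c b \<in> S) \<and> x = (\<Sum>b\<in>A. c b * b))"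
  note ins = lin_indep_insert[OF A(1) x]
  have "card (insert x A) \<le> card B" using card_lin_indep_le[OF ins(2) _ B] A(2) xL by simp
  then show False using ins(1) lin_indep_imp_finite[OF A(1)] card by simp
qed

text \<open>A spanning set of E bounds the size of independent subsets, so a largest one exists in
  \<open>L\<close>, and any element outside its span could be added. \<open>L\<close> is an
  arbitrary subset so that rings not yet known to be fields are covered.\<close>

lemma subset_has_basis:
  assumes "finite_ext S UNIV"
  shows "\<exists>B. basis_over S L B"
proof -
  obtain B where B: "finite B" "spans_over S B UNIV"
    using assms by (auto simp: finite_ext_def basis_over_def)
  have "lin_indep_over S {} \<and> {} \<subseteq> L" by (simp add: lin_indep_over_def)
  moreover have "\<forall>A. lin_indep_over S A \<and> A \<subseteq> L \<longrightarrow> card A < Suc (card B)"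
    using card_lin_indep_le[OF _ subset_UNIV B] by (auto simp: less_Suc_eq_le)
  ultimately obtain A where A: "lin_indep_over S A" "A \<subseteq> L"
    "\<And>A'. lin_indep_over S A' \<Longrightarrow> A' \<subseteq> L \<Longrightarrow> card A' \<le> card A"
    using ex_has_greatest_nat[of "\<lambda>A. lin_indep_over S A \<and> A \<subseteq> L" "{}" card "Suc (card B)"]
    by auto
  have "spans_over S A L"
    unfolding spans_over_def
  proof (rule ballI, rule ccontr)
    fix x assume xL: "x \<in> L" and x: "\<not> (\<exists>c. (\<forall>b\<in>A. c b \<in> S) \<and> x = (\<Sum>b\<in>A. c b * b))"
    note ins = lin_indep_insert[OF A(1) x]
    have "card (insert x A) \<le> card A" using A(2) xL by (intro A(3) ins(2)) auto
    then show False using ins(1) lin_indep_imp_finite[OF A(1)] by simp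
  qed
  then show ?thesis using A lin_indep_imp_finite[OF A(1)] by (auto simp: basis_over_def)
qed

lemma lin_indep_scale:
  assumes B: "lin_indep_over S B" and x: "x \<noteq> 0"
  shows "lin_indep_over S ((*) x ` B)"
  unfolding lin_indep_over_def
proof (intro allI impI)
  fix c assume c: "\<forall>b\<in>(*) x ` B. c b \<in> S" and s: "(\<Sum>b\<in>(*) x ` B. c b * b) = 0"
  have "(\<Sum>b\<in>(*) x ` B. c b * b) = (\<Sum>b\<in>B. c (x * b) * (x * b))"
    using x by (subst sum.reindex) (auto intro: inj_onI)
  also have "\<dots> = x * (\<Sum>b\<in>B. c (x * b) * b)" by (simp add: sum_distrib_left mult_ac)
  finally have "(\<Sum>b\<in>B. c (x * b) * b) = 0" using s x by simp
  moreover have "\<forall>b\<in>B. c (x * b) \<in> S" using c by simp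
  ultimately have "\<forall>b\<in>B. c (x * b) = 0"
    using spec[OF B[unfolded lin_indep_over_def], of "\<lambda>b. c (x * b)"] by blast
  then show "\<forall>b\<in>(*) x ` B. c b = 0" by simp
qed

text \<open>Multiplication by a nonzero x carries a basis of R to an independent set of the same
  size, hence to a spanning set of R. Expressing 1 in it exhibits the inverse of x in R.\<close>

lemma subring_is_subfield:
  assumes fe: "finite_ext S UNIV" and R: "subring_set R" and SR: "S \<subseteq> R"
  shows "is_subfield R"
proof -
  interpret R: subring_set R by fact
  have "inverse x \<in> R" if x: "x \<in> R" "x \<noteq> 0" for x
  proof -
    obtain B where B: "basis_over S R B" using subset_has_basis[OF fe] by blast
    then have B': "finite B" "B \<subseteq> R" "lin_indep_over S B" "spans_over S B R"
      by (auto simp: basis_over_def)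
    have inj: "inj_on ((*) x) B" using x by (auto intro: inj_onI)
    have "spans_over S ((*) x ` B) R"
    proof (rule lin_indep_card_eq_imp_spans[OF lin_indep_scale[OF B'(3) x(2)] _ B'(1,4)])
      show "(*) x ` B \<subseteq> R" using B'(2) x by auto
      show "card B \<le> card ((*) x ` B)" using inj by (simp add: card_image)
    qed
    then obtain c where c: "\<forall>b\<in>(*) x ` B. c b \<in> S" "1 = (\<Sum>b\<in>(*) x ` B. c b * b)"
      unfolding spans_over_def using R.one_mem by blast
    have "1 = x * (\<Sum>b\<in>B. c (x * b) * b)"
      unfolding c(2) sum.reindex[OF inj] by (simp add: sum_distrib_left mult_ac)
    then have "inverse x = (\<Sum>b\<in>B. c (x * b) * b)" by (metis inverse_unique)
    also have "\<dots> \<in> R" using c(1) SR B'(2) by (intro R.sum_mem R.mult_mem) auto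
    finally show ?thesis .
  qed
  then show ?thesis by (auto simp: is_subfield_def)
qed

section \<open>Adjunction of one element\<close>

definition adjoin :: "'a \<Rightarrow> 'a set" where
  "adjoin x = {poly p x | p. coeffs_in S p}"

lemma adjoinI: "coeffs_in S p \<Longrightarrow> poly p x \<in> adjoin x"
  by (auto simp: adjoin_def)

lemma subset_adjoin: "S \<subseteq> adjoin x"
proof
  fix a assume "a \<in> S"
  then show "a \<in> adjoin x" using adjoinI[of "[:a:]" x] by (simp add: coeffs_in_pCons_iff)
qed

lemma mem_adjoin: "x \<in> adjoin x"
  using adjoinI[of "[:0, 1:]" x] by (simp add: coeffs_in_pCons_iff)

lemma subring_adjoin: "subring_set (adjoin x)"
proof
  fix a b assume "a \<in> adjoin x" "b \<in> adjoin x"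
  then obtain p q where pq: "coeffs_in S p" "coeffs_in S q" "a = poly p x" "b = poly q x"
    by (auto simp: adjoin_def)
  show "a + b \<in> adjoin x" using adjoinI[OF coeffs_in_add[OF pq(1,2)]] pq by simp
  show "a - b \<in> adjoin x" using adjoinI[OF coeffs_in_diff[OF pq(1,2)]] pq by simp
  show "a * b \<in> adjoin x" using adjoinI[OF coeffs_in_mult[OF pq(1,2)]] pq by simp
qed (use subset_adjoin[of x] zero_mem one_mem in blast)+

end

lemma poly_eq_sum_lessThan:
  fixes r :: "'a::field poly"
  assumes "\<forall>i\<ge>d. coeff r i = 0"
  shows "poly r x = (\<Sum>i<d. coeff r i * x ^ i)"
proof -
  have "(\<Sum>i\<le>Polynomial.degree r. coeff r i * x ^ i) = (\<Sum>i<d. coeff r i * x ^ i)"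
    using assms
    by (intro sum.mono_neutral_cong) (auto simp: coeff_eq_0 not_le not_less)
  then show ?thesis by (simp add: poly_altdef)
qed

lemma (in subfield_set) adjoin_spanned_by_powers:
  assumes g: "coeffs_in S g" "lead_coeff g = 1" "poly g x = 0" and y: "y \<in> adjoin x"
  shows "\<exists>c. (\<forall>i. c i \<in> S) \<and> y = (\<Sum>i<Polynomial.degree g. c i * x ^ i)"
proof -
  obtain p where p: "coeffs_in S p" "y = poly p x" using y by (auto simp: adjoin_def)
  obtain h r where hr: "coeffs_in S r" "p = g * h + r" "\<forall>i\<ge>Polynomial.degree g. coeff r i = 0"
    using monic_division[OF g(1,2) p(1)] by blast
  have "y = poly r x" using p(2) hr(2) g(3) by simp
  then show ?thesis
    using poly_eq_sum_lessThan[OF hr(3)] hr(1) by (auto simp: coeffs_in_def)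
qed

section \<open>Residual independence\<close>

context valued_field
begin

text \<open>Linear independence of residues over the residue field of \<open>S\<close>, phrased
  through lifts of the coefficients. The family is indexed so that powers of an element can be used
  before they are known to be distinct.\<close>

definition res_indep :: "'a set \<Rightarrow> 'i set \<Rightarrow> ('i \<Rightarrow> 'a) \<Rightarrow> bool" where
  "res_indep S I w \<longleftrightarrow> (\<forall>c. (\<forall>i\<in>I. c i \<in> S \<inter> P 0) \<longrightarrow> (\<Sum>i\<in>I. c i * w i) \<in> P 1 \<longrightarrow>
     (\<forall>i\<in>I. c i \<in> P 1))"

lemma res_indepD:
  assumes "res_indep S I w" "\<And>i. i \<in> I \<Longrightarrow> c i \<in> S \<inter> P 0" "(\<Sum>i\<in>I. c i * w i) \<in> P 1" "i \<in> I"
  shows "c i \<in> P 1"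
  using assms unfolding res_indep_def by blast

text \<open>Dividing by a coefficient of least valuation gives integral coefficients, one of them 1,
  and residual independence makes that combination a unit.\<close>

lemma res_indep_sum_val:
  assumes S: "subfield_set S" and I: "finite I" and w: "\<And>i. i \<in> I \<Longrightarrow> w i \<in> P 0"
    and ri: "res_indep S I w" and c: "\<And>i. i \<in> I \<Longrightarrow> c i \<in> S" and nz: "\<exists>i\<in>I. c i \<noteq> 0"
  shows "\<exists>i\<in>I. c i \<noteq> 0 \<and> (\<Sum>i\<in>I. c i * w i) \<noteq> 0 \<and> v (\<Sum>i\<in>I. c i * w i) = v (c i)"
proof -
  interpret subfield_set S by fact
  let ?J = "{i \<in> I. c i \<noteq> 0}"
  have "finite (v ` c ` ?J)" "v ` c ` ?J \<noteq> {}" using I nz by auto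
  from Min_in[OF this] obtain i0 where i0: "i0 \<in> I" "c i0 \<noteq> 0" "v (c i0) = Min (v ` c ` ?J)" by auto
  have min: "v (c i0) \<le> v (c i)" if "i \<in> I" "c i \<noteq> 0" for i
    unfolding i0(3) using I that by (intro Min_le) auto
  define d where "d i = c i / c i0" for i
  have d: "d i \<in> S \<inter> P 0" if "i \<in> I" for i
    using c[OF that] c[OF i0(1)] i0 min[OF that]
    by (cases "c i = 0") (auto simp: d_def vball_def v_divide)
  have d0: "d i0 = 1" using i0 by (simp add: d_def)
  let ?s = "\<Sum>i\<in>I. d i * w i"
  have "?s \<notin> P 1" using res_indepD[OF ri d, of "\<lambda>i. i" i0] i0(1) d0 by auto
  moreover have "?s \<in> P 0" using d w by (auto intro!: vball_mult_left)
  ultimately have s: "?s \<noteq> 0" "v ?s = 0" using unitD by auto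
  have "(\<Sum>i\<in>I. c i * w i) = c i0 * ?s"
    using i0 by (simp add: d_def sum_distrib_left)
  then show ?thesis using s i0 by (intro bexI[of _ i0]) (auto simp: v_mult)
qed

lemma res_indep_image:
  assumes inj: "inj_on w I" and ri: "res_indep S I w"
  shows "res_indep S (w ` I) (\<lambda>b. b)"
  unfolding res_indep_def
proof (intro allI impI)
  fix c assume c: "\<forall>b\<in>w ` I. c b \<in> S \<inter> P 0" and s: "(\<Sum>b\<in>w ` I. c b * b) \<in> P 1"
  have "(\<Sum>i\<in>I. c (w i) * w i) \<in> P 1" using s by (simp add: sum.reindex[OF inj])
  then show "\<forall>b\<in>w ` I. c b \<in> P 1" using res_indepD[OF ri, of "\<lambda>i. c (w i)"] c by auto
qed

lemma res_indep_imp_lin_indep: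
  assumes S: "subfield_set S" and B: "finite B" "B \<subseteq> P 0" and ri: "res_indep S B (\<lambda>b. b)"
  shows "lin_indep_over S B"
  unfolding lin_indep_over_def
proof (intro allI impI, rule ccontr)
  fix c assume "\<forall>b\<in>B. c b \<in> S" "(\<Sum>b\<in>B. c b * b) = 0" "\<not> (\<forall>b\<in>B. c b = 0)"
  then show False using res_indep_sum_val[OF S B(1) _ ri, of c] B(2) by blast
qed

text \<open>\<open>KS\<close> says that \<open>K\<close> has no residues beyond those of
  \<open>S\<close>, so coefficients can be replaced by congruent ones from \<open>S\<close>. For a
  totally ramified \<open>K\<close> this is the source of linear disjointness from
  \<open>U\<close>.\<close>

lemma res_indep_extend:
  assumes ri: "res_indep S I w" and w: "\<And>i. i \<in> I \<Longrightarrow> w i \<in> P 0"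
    and KS: "\<And>x. x \<in> K \<Longrightarrow> x \<in> P 0 \<Longrightarrow> \<exists>c\<in>S \<inter> P 0. x - c \<in> P 1"
  shows "res_indep K I w"
  unfolding res_indep_def
proof (intro allI impI ballI)
  fix a j assume a: "\<forall>i\<in>I. a i \<in> K \<inter> P 0" and s: "(\<Sum>i\<in>I. a i * w i) \<in> P 1" and j: "j \<in> I"
  have "\<forall>i\<in>I. \<exists>c\<in>S \<inter> P 0. a i - c \<in> P 1" using a KS by blast
  then obtain c where c: "\<And>i. i \<in> I \<Longrightarrow> c i \<in> S \<inter> P 0 \<and> a i - c i \<in> P 1" by metis
  have "(\<Sum>i\<in>I. (a i - c i) * w i) \<in> P 1" using c w by (intro vball_sum vball_mult_right) auto
  then have "(\<Sum>i\<in>I. c i * w i) \<in> P 1"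
    using vball_diff[OF s, of "\<Sum>i\<in>I. (a i - c i) * w i"] by (simp add: left_diff_distrib sum_subtractf)
  then have "c j \<in> P 1" using res_indepD[OF ri _ _ j] c by blast
  then show "a j \<in> P 1" using vball_add[of "a j - c j" 1 "c j"] c[OF j] by simp
qed

text \<open>The term of least valuation is alone at that valuation, so the other terms cannot cancel
  it.\<close>

lemma distinct_vals_sum:
  assumes I: "finite I"
    and dist: "\<And>i j. i \<in> I \<Longrightarrow> j \<in> I \<Longrightarrow> t i \<noteq> 0 \<Longrightarrow> t j \<noteq> 0 \<Longrightarrow> v (t i) = v (t j) \<Longrightarrow> i = j"
    and s: "(\<Sum>i\<in>I. t i) \<in> P n" and i: "i \<in> I"
  shows "t i \<in> P n"
proof (rule ccontr)
  assume ti: "t i \<notin> P n"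
  let ?J = "{i \<in> I. t i \<noteq> 0}"
  have "i \<in> ?J" using i ti by auto
  then have "finite (v ` t ` ?J)" "v ` t ` ?J \<noteq> {}" using I by auto
  from Min_in[OF this] obtain i0 where i0: "i0 \<in> I" "t i0 \<noteq> 0" "v (t i0) = Min (v ` t ` ?J)" by auto
  have min: "v (t i0) \<le> v (t j)" if "j \<in> I" "t j \<noteq> 0" for j
    unfolding i0(3) using I that by (intro Min_le) auto
  have lt: "v (t i0) < n" using min[OF i] ti by (auto simp: vball_def)
  have "t j \<in> P (v (t i0) + 1)" if "j \<in> I - {i0}" for j
  proof (cases "t j = 0")
    case False
    then show ?thesis using min[of j] dist[of i0 j] that i0 by (force simp: vball_def)
  qed simp
  then have "(\<Sum>j\<in>I - {i0}. t j) \<in> P (v (t i0) + 1)" by blast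
  moreover have "(\<Sum>i\<in>I. t i) \<in> P (v (t i0) + 1)" using s lt by (auto elim: vball_mono)
  moreover have "t i0 = (\<Sum>i\<in>I. t i) - (\<Sum>j\<in>I - {i0}. t j)" using I i0 by (simp add: sum.remove)
  ultimately have "t i0 \<in> P (v (t i0) + 1)" by (metis vball_diff)
  then show False using i0 by (simp add: vball_def)
qed

end

section \<open>From spanning modulo a uniformizer to spanning\<close>

context valued_subfield
begin

text \<open>Successive approximation: the error is divisible by a uniformizer of \<open>S\<close>,
  the quotient is approximated again, and completeness of \<open>S\<close> makes the partial sums of
  each coordinate converge. The closure properties of \<open>L\<close> let it be an unramified
  subfield as well as all of E.\<close>

lemma integral_span_of_residual_span:
  assumes complete: "complete_on S v" and I: "finite I"
    and w: "\<And>i. i \<in> I \<Longrightarrow> w i \<in> L" "\<And>i. i \<in> I \<Longrightarrow> w i \<in> P 0"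
    and L: "\<And>x y. x \<in> L \<Longrightarrow> y \<in> L \<Longrightarrow> x - y \<in> L" "\<And>a x. a \<in> S \<Longrightarrow> x \<in> L \<Longrightarrow> a * x \<in> L"
      "\<And>c. (\<And>i. i \<in> I \<Longrightarrow> c i \<in> S) \<Longrightarrow> (\<Sum>i\<in>I. c i * w i) \<in> L"
    and approx: "\<And>x. x \<in> L \<Longrightarrow> x \<in> P 0 \<Longrightarrow> \<exists>c. (\<forall>i\<in>I. c i \<in> S \<inter> P 0) \<and>
      x - (\<Sum>i\<in>I. c i * w i) \<in> P (int (vmin S v))"
    and x: "x \<in> L" "x \<in> P 0"
  shows "\<exists>c. (\<forall>i\<in>I. c i \<in> S) \<and> x = (\<Sum>i\<in>I. c i * w i)"
proof -
  obtain \<pi> where \<pi>: "\<pi> \<in> S" "\<pi> \<noteq> 0" "v \<pi> = int (vmin S v)" using vmin_attained by blast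
  have \<pi>P: "\<pi> ^ n \<in> P (int n)" for n
  proof -
    have "int n * 1 \<le> int n * int (vmin S v)" using vmin_pos by (intro mult_left_mono) auto
    then show ?thesis using \<pi> by (simp add: vball_def v_power)
  qed
  obtain C where C: "\<And>y i. y \<in> L \<Longrightarrow> y \<in> P 0 \<Longrightarrow> i \<in> I \<Longrightarrow> C y i \<in> S \<inter> P 0"
    "\<And>y. y \<in> L \<Longrightarrow> y \<in> P 0 \<Longrightarrow> y - (\<Sum>i\<in>I. C y i * w i) \<in> P (int (vmin S v))"
    using approx by metis
  define X where "X = rec_nat x (\<lambda>_ y. inverse \<pi> * (y - (\<Sum>i\<in>I. C y i * w i)))"
  have X0: "X 0 = x" and XS: "X (Suc n) = inverse \<pi> * (X n - (\<Sum>i\<in>I. C (X n) i * w i))" for n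
    by (simp_all add: X_def)
  have X: "X n \<in> L \<and> X n \<in> P 0" for n
  proof (induction n)
    case (Suc n)
    have "(\<Sum>i\<in>I. C (X n) i * w i) \<in> L" using Suc C(1) by (intro L(3)) blast
    then have "X (Suc n) \<in> L" unfolding XS using Suc \<pi> by (intro L(1,2) inverse_mem) auto
    moreover have "inverse \<pi> \<in> P (- int (vmin S v))" using \<pi> by (simp add: vball_def v_inverse)
    from vball_mult[OF this C(2)[of "X n"]] have "X (Suc n) \<in> P 0" using Suc by (simp add: XS)
    ultimately show ?case ..
  qed (simp add: X0 x)
  define s where "s n i = (\<Sum>m<n. C (X m) i * \<pi> ^ m)" for n i
  have expand: "x = (\<Sum>i\<in>I. s n i * w i) + \<pi> ^ n * X n" for n
  proof (induction n)
    case 0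
    then show ?case by (simp add: s_def X0)
  next
    case (Suc n)
    have "\<pi> ^ n * X n = \<pi> ^ n * (\<Sum>i\<in>I. C (X n) i * w i) + \<pi> ^ Suc n * X (Suc n)"
      using \<pi> by (simp add: XS field_simps)
    moreover have "(\<Sum>i\<in>I. s (Suc n) i * w i)
        = (\<Sum>i\<in>I. s n i * w i) + \<pi> ^ n * (\<Sum>i\<in>I. C (X n) i * w i)"
      by (simp add: s_def sum.distrib[symmetric] sum_distrib_left algebra_simps)
    ultimately show ?case using Suc by (simp add: add.assoc)
  qed
  have "\<exists>c\<in>S. \<forall>n. s n i - c \<in> P (int n)" if i: "i \<in> I" for i
  proof (rule complete_limit[OF complete])
    show "s n i \<in> S" for n unfolding s_def using C(1) X i \<pi> by (intro sum_mem mult_mem power_mem) auto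
    show "s (Suc n) i - s n i \<in> P (int n)" for n
      using vball_mult_left[OF _ \<pi>P] C(1) X i by (simp add: s_def)
  qed
  then obtain c where c: "\<And>i. i \<in> I \<Longrightarrow> c i \<in> S" "\<And>i n. i \<in> I \<Longrightarrow> s n i - c i \<in> P (int n)" by metis
  have "x - (\<Sum>i\<in>I. c i * w i) \<in> P (int n)" for n
  proof -
    have "x - (\<Sum>i\<in>I. c i * w i) = (\<Sum>i\<in>I. (s n i - c i) * w i) + \<pi> ^ n * X n"
      using expand[of n] by (simp add: left_diff_distrib sum_subtractf)
    also have "\<dots> \<in> P (int n)"
      using c w X[of n] \<pi>P by (intro vball_add vball_sum vball_mult_right) auto
    finally show ?thesis .
  qed
  then have "x - (\<Sum>i\<in>I. c i * w i) = 0" by (rule vball_all_imp_zero)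
  then show ?thesis using c(1) by auto
qed

lemma span_of_residual_span:
  assumes complete: "complete_on S v" and I: "finite I"
    and w: "\<And>i. i \<in> I \<Longrightarrow> w i \<in> L" "\<And>i. i \<in> I \<Longrightarrow> w i \<in> P 0"
    and L: "\<And>x y. x \<in> L \<Longrightarrow> y \<in> L \<Longrightarrow> x - y \<in> L" "\<And>a x. a \<in> S \<Longrightarrow> x \<in> L \<Longrightarrow> a * x \<in> L"
      "\<And>c. (\<And>i. i \<in> I \<Longrightarrow> c i \<in> S) \<Longrightarrow> (\<Sum>i\<in>I. c i * w i) \<in> L"
    and approx: "\<And>x. x \<in> L \<Longrightarrow> x \<in> P 0 \<Longrightarrow> \<exists>c. (\<forall>i\<in>I. c i \<in> S \<inter> P 0) \<and>
      x - (\<Sum>i\<in>I. c i * w i) \<in> P (int (vmin S v))"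
    and x: "x \<in> L"
  shows "\<exists>c. (\<forall>i\<in>I. c i \<in> S) \<and> x = (\<Sum>i\<in>I. c i * w i)"
proof -
  obtain \<pi> where \<pi>: "\<pi> \<in> S" "\<pi> \<noteq> 0" "v \<pi> = int (vmin S v)" using vmin_attained by blast
  \<comment> \<open>Each factor \<open>\<pi>\<close> raises the valuation by at least 1, so
    \<open>m\<close> of them clear the denominator of \<open>x\<close>.\<close>
  define m where "m = nat (- v x)"
  have xP: "\<pi> ^ m * x \<in> P 0"
  proof (cases "x = 0")
    case False
    have "int m * 1 \<le> int m * int (vmin S v)" using vmin_pos by (intro mult_left_mono) auto
    moreover have "0 \<le> int m + v x" by (simp add: m_def)
    ultimately have "0 \<le> int m * int (vmin S v) + v x" by linarith
    then show ?thesis using \<pi> False by (simp add: vball_def v_mult v_power)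
  qed simp
  have xL: "\<pi> ^ m * x \<in> L" using \<pi> x by (intro L(2) power_mem)
  have "\<exists>c. (\<forall>i\<in>I. c i \<in> S) \<and> \<pi> ^ m * x = (\<Sum>i\<in>I. c i * w i)"
    by (rule integral_span_of_residual_span[of I w L]) fact+
  then obtain c where c: "\<forall>i\<in>I. c i \<in> S" "\<pi> ^ m * x = (\<Sum>i\<in>I. c i * w i)" by blast
  have "x = inverse (\<pi> ^ m) * (\<pi> ^ m * x)" using \<pi> by simp
  also have "\<dots> = (\<Sum>i\<in>I. (inverse (\<pi> ^ m) * c i) * w i)"
    unfolding c(2) sum_distrib_left by (simp add: mult.assoc)
  finally have "x = (\<Sum>i\<in>I. (inverse (\<pi> ^ m) * c i) * w i)" .
  moreover have "\<forall>i\<in>I. inverse (\<pi> ^ m) * c i \<in> S" using c(1) \<pi> by auto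
  ultimately show ?thesis by (intro exI[of _ "\<lambda>i. inverse (\<pi> ^ m) * c i"]) (rule conjI)
qed

end

section \<open>Tensor decompositions\<close>

context tame_extension
begin

lemma valued_subfield_above:
  assumes "is_subfield L" "k \<subseteq> L"
  shows "valued_subfield v L"
  using assms nontrivial by unfold_locales auto

lemma vmin_dvd_vmin_k:
  assumes "is_subfield L" "k \<subseteq> L"
  shows "vmin L v dvd e"
proof -
  interpret L: valued_subfield v L by (rule valued_subfield_above[OF assms])
  obtain \<pi> where "\<pi> \<in> k" "\<pi> \<noteq> 0" "v \<pi> = int e" using vmin_attained by blast
  then show ?thesis using L.vmin_dvd[of \<pi>] assms(2) by auto
qed

lemma ram_index_mult: "is_subfield L \<Longrightarrow> k \<subseteq> L \<Longrightarrow> e = ram_index v L k * vmin L v"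
  using vmin_dvd_vmin_k by (simp add: ram_index_def)

text \<open>Nonzero elements of k have valuation divisible by e = n l, so the terms have valuations
  congruent to i l modulo n l, and these differ for different i < n.\<close>

lemma terms_distinct_vals:
  assumes \<pi>: "\<pi> \<noteq> 0" "v \<pi> = int l" and e: "e = n * l"
    and c: "c i \<in> k" "c j \<in> k" "c i \<noteq> 0" "c j \<noteq> 0" and ij: "i < n" "j < n"
    and eq: "v (c i * \<pi> ^ i) = v (c j * \<pi> ^ j)"
  shows "i = j"
proof -
  have l: "l > 0" using vmin_pos e by (cases l) auto
  have "v (c i) - v (c j) = (int j - int i) * int l"
    using eq \<pi> c by (simp add: v_mult v_power algebra_simps)
  moreover have "int e dvd v (c i) - v (c j)" using vmin_dvd c by (intro dvd_diff) auto
  ultimately have "int n * int l dvd (int j - int i) * int l" using e by simp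
  then have "int n dvd int j - int i" using l by simp
  then show ?thesis using ij zdvd_imp_le[of "int n" "int j - int i"] zdvd_imp_le[of "int n" "int i - int j"]
    by (cases i j rule: linorder_cases) (auto simp: dvd_diff_commute)
qed

lemma power_combination_integral:
  assumes \<pi>: "\<pi> \<noteq> 0" "v \<pi> = int l" and e: "e = n * l"
    and c: "\<And>i. i < n \<Longrightarrow> c i \<in> k" and s: "(\<Sum>i<n. c i * \<pi> ^ i) \<in> P m" and i: "i < n"
  shows "c i * \<pi> ^ i \<in> P m"
  using distinct_vals_sum[of "{..<n}" "\<lambda>i. c i * \<pi> ^ i" m i] s i
    terms_distinct_vals[OF \<pi> e, of c] c by auto

text \<open>A nonzero term with i > 0 is integral and has valuation different from 0, hence lies in
  p. The sum is therefore congruent to its constant term.\<close>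

lemma power_combination_residue:
  assumes \<pi>: "\<pi> \<noteq> 0" "v \<pi> = int l" and e: "e = n * l"
    and c: "\<And>i. i < n \<Longrightarrow> c i \<in> k" and x: "x = (\<Sum>i<n. c i * \<pi> ^ i)" "x \<in> P 0"
  shows "\<exists>d\<in>k \<inter> P 0. x - d \<in> P 1"
proof -
  have n: "n > 0" using vmin_pos e by (cases n) auto
  have t: "c i * \<pi> ^ i \<in> P 0" if "i < n" for i
    using power_combination_integral[where m = 0 and i = i, OF \<pi> e c] x that by simp
  have t1: "c i * \<pi> ^ i \<in> P 1" if "i < n" "i \<noteq> 0" for i
  proof (rule ccontr)
    assume "c i * \<pi> ^ i \<notin> P 1"
    then have nz: "c i * \<pi> ^ i \<noteq> 0" "v (c i * \<pi> ^ i) = 0" using unitD[OF t[OF that(1)]] by auto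
    \<comment> \<open>Putting 1 in place of the constant coefficient compares the term
      \<open>i\<close> with an element of valuation 0.\<close>
    then show False
      using terms_distinct_vals[OF \<pi> e, of "c(0 := 1)" i 0] that c n by auto
  qed
  have "x = c 0 + (\<Sum>i\<in>{..<n} - {0}. c i * \<pi> ^ i)"
    using n by (simp add: x(1) sum.remove[of "{..<n}" 0])
  moreover have "(\<Sum>i\<in>{..<n} - {0}. c i * \<pi> ^ i) \<in> P 1" using t1 by auto
  ultimately have "x - c 0 \<in> P 1" by simp
  moreover have "c 0 \<in> k \<inter> P 0" using c[OF n] t[OF n] by simp
  ultimately show ?thesis by blast
qed

lemma powers_inj:
  assumes \<pi>: "\<pi> \<noteq> 0" "v \<pi> = int l" and l: "l > 0"
  shows "inj_on (\<lambda>i. \<pi> ^ i) A"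
proof (rule inj_onI)
  fix i j assume "\<pi> ^ i = \<pi> ^ j"
  then have "v (\<pi> ^ i) = v (\<pi> ^ j)" by simp
  then show "i = j" using \<pi> l by (simp add: v_power)
qed

lemma powers_lin_indep:
  assumes \<pi>: "\<pi> \<noteq> 0" "v \<pi> = int l" and e: "e = n * l"
  shows "lin_indep_over k ((\<lambda>i. \<pi> ^ i) ` {..<n})"
  unfolding lin_indep_over_def
proof (intro allI impI)
  fix c assume c: "\<forall>b\<in>(\<lambda>i. \<pi> ^ i) ` {..<n}. c b \<in> k"
    and s: "(\<Sum>b\<in>(\<lambda>i. \<pi> ^ i) ` {..<n}. c b * b) = 0"
  have "l > 0" using vmin_pos e by (cases l) auto
  note inj = powers_inj[OF \<pi> this, of "{..<n}"]
  have "(\<Sum>i<n. c (\<pi> ^ i) * \<pi> ^ i) = 0" using s by (simp add: sum.reindex[OF inj])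
  then have "c (\<pi> ^ i) * \<pi> ^ i \<in> P m" if "i < n" for i m
    using power_combination_integral[OF \<pi> e, of "\<lambda>i. c (\<pi> ^ i)" m i] c that by simp
  then have "c (\<pi> ^ i) * \<pi> ^ i = 0" if "i < n" for i using that by (intro vball_all_imp_zero)
  then show "\<forall>b\<in>(\<lambda>i. \<pi> ^ i) ` {..<n}. c b = 0" using \<pi> by auto
qed

text \<open>The degree equals the ramification index, so the independent powers of a uniformizer of
  \<open>K\<close> already form a basis over k, and their valuations leave only residues of
  k.\<close>

lemma totally_ramified_residue:
  assumes K: "is_subfield K" "k \<subseteq> K" "totally_ramified v K k" and x: "x \<in> K" "x \<in> P 0"
  shows "\<exists>d\<in>k \<inter> P 0. x - d \<in> P 1"
proof -
  interpret K: valued_subfield v K by (rule valued_subfield_above[OF K(1,2)])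
  define n where "n = ram_index v K k"
  have e: "e = n * vmin K v" unfolding n_def by (rule ram_index_mult[OF K(1,2)])
  obtain \<pi> where \<pi>: "\<pi> \<in> K" "\<pi> \<noteq> 0" "v \<pi> = int (vmin K v)" using K.vmin_attained by blast
  note inj = powers_inj[OF \<pi>(2,3) K.vmin_pos, of "{..<n}"]
  obtain B where B: "basis_over k K B" using subset_has_basis[OF fin_ext] by blast
  then have card: "card B = n" using degree_eq_card[OF B] K(3) by (simp add: totally_ramified_def n_def)
  have "spans_over k ((\<lambda>i. \<pi> ^ i) ` {..<n}) K"
  proof (rule lin_indep_card_eq_imp_spans[OF powers_lin_indep[OF \<pi>(2,3) e]])
    show "(\<lambda>i. \<pi> ^ i) ` {..<n} \<subseteq> K" using \<pi>(1) by auto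
    show "finite B" "spans_over k B K" using B by (auto simp: basis_over_def)
    show "card B \<le> card ((\<lambda>i. \<pi> ^ i) ` {..<n})" using card by (simp add: card_image[OF inj])
  qed
  then obtain c where c: "\<forall>b\<in>(\<lambda>i. \<pi> ^ i) ` {..<n}. c b \<in> k"
    "x = (\<Sum>b\<in>(\<lambda>i. \<pi> ^ i) ` {..<n}. c b * b)"
    using x(1) unfolding spans_over_def by blast
  have "x = (\<Sum>i<n. c (\<pi> ^ i) * \<pi> ^ i)" using c(2) by (simp add: sum.reindex[OF inj])
  then show ?thesis
    using power_combination_residue[OF \<pi>(2,3) e, of "\<lambda>i. c (\<pi> ^ i)" x] c(1) x(2) by auto
qed

text \<open>Residually independent sets are linearly independent over k, hence bounded in size, and
  a largest one exists. An element whose residue lay outside its span could be added.\<close>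

lemma residue_basis_exists:
  assumes U: "is_subfield U" "k \<subseteq> U"
  shows "\<exists>B. finite B \<and> B \<subseteq> U \<inter> P 0 \<and> res_indep k B (\<lambda>b. b) \<and>
    (\<forall>x\<in>U \<inter> P 0. \<exists>c. (\<forall>b\<in>B. c b \<in> k \<inter> P 0) \<and> x - (\<Sum>b\<in>B. c b * b) \<in> P 1)"
proof -
  let ?Q = "\<lambda>B. finite B \<and> B \<subseteq> U \<inter> P 0 \<and> res_indep k B (\<lambda>b. b)"
  obtain B0 where B0: "finite B0" "spans_over k B0 UNIV"
    using fin_ext by (auto simp: finite_ext_def basis_over_def)
  have "?Q {}" by (simp add: res_indep_def)
  moreover have "\<forall>B. ?Q B \<longrightarrow> card B < Suc (card B0)"
    using card_lin_indep_le[OF res_indep_imp_lin_indep[OF subfield_k] subset_UNIV B0]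
    by (auto simp: less_Suc_eq_le)
  ultimately obtain B where B: "?Q B" "\<And>B'. ?Q B' \<Longrightarrow> card B' \<le> card B"
    using ex_has_greatest_nat[of ?Q "{}" card "Suc (card B0)"] by auto
  have "\<exists>c. (\<forall>b\<in>B. c b \<in> k \<inter> P 0) \<and> x - (\<Sum>b\<in>B. c b * b) \<in> P 1" if x: "x \<in> U \<inter> P 0" for x
  proof (rule ccontr)
    assume no: "\<not> ?thesis"
    have no': "x - (\<Sum>b\<in>B. c b * b) \<notin> P 1" if "\<forall>b\<in>B. c b \<in> k \<inter> P 0" for c
      using no that by blast
    have xB: "x \<notin> B"
    proof
      assume "x \<in> B"
      then have "(\<Sum>b\<in>B. (if b = x then 1 else 0) * b) = x"
        using B(1) by (simp add: if_distrib[of "\<lambda>c. c * _"] cong: if_cong)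
      moreover have "\<forall>b\<in>B. (if b = x then 1 else 0) \<in> k \<inter> P 0" by simp
      note no'[OF this]
      ultimately show False by simp
    qed
    have "res_indep k (insert x B) (\<lambda>b. b)"
      unfolding res_indep_def
    proof (intro allI impI)
      fix c assume c: "\<forall>b\<in>insert x B. c b \<in> k \<inter> P 0" and s: "(\<Sum>b\<in>insert x B. c b * b) \<in> P 1"
      have s': "c x * x + (\<Sum>b\<in>B. c b * b) \<in> P 1" using s xB B(1) by simp
      \<comment> \<open>A unit coefficient at \<open>x\<close> could be divided out, putting the
        residue of \<open>x\<close> into the span after all.\<close>
      have cx: "c x \<in> P 1"
      proof (rule ccontr)
        assume "c x \<notin> P 1"
        then have u: "c x \<noteq> 0" "v (c x) = 0" using unitD c by auto
        have "(c x * x + (\<Sum>b\<in>B. c b * b)) / c x = x - (\<Sum>b\<in>B. (- c b / c x) * b)"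
          using u by (simp add: add_divide_distrib sum_divide_distrib sum_negf)
        then have "x - (\<Sum>b\<in>B. (- c b / c x) * b) \<in> P 1"
          using vball_divide_unit[OF s' u] by simp
        moreover have "\<forall>b\<in>B. - c b / c x \<in> k \<inter> P 0"
          using c u by (auto intro!: vball_divide_unit)
        ultimately show False using no'[of "\<lambda>b. - c b / c x"] by simp
      qed
      then have "(\<Sum>b\<in>B. c b * b) \<in> P 1"
        using vball_diff[OF s', of "c x * x"] x vball_mult_right[of "c x" 1 x] by simp
      then have "\<forall>b\<in>B. c b \<in> P 1" using res_indepD[of k B "\<lambda>b. b" c] B(1) c by blast
      with cx show "\<forall>b\<in>insert x B. c b \<in> P 1" by simp
    qed
    then have "card (insert x B) \<le> card B" using B x by (intro B(2)) auto
    then show False using xB B(1) by simp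
  qed
  with B(1) show ?thesis by blast
qed

text \<open>A uniformizer of k is one of \<open>U\<close>, so approximating elements of
  \<open>U\<close> modulo p_E already approximates them modulo p_k and can be iterated.\<close>

lemma unramified_residue_basis_spans:
  assumes U: "is_subfield U" "k \<subseteq> U" "unramified v U k"
  shows "\<exists>B. finite B \<and> B \<subseteq> U \<inter> P 0 \<and> res_indep k B (\<lambda>b. b) \<and> spans_over k B U"
proof -
  interpret U: valued_subfield v U by (rule valued_subfield_above[OF U(1,2)])
  have eU: "vmin U v = e" using ram_index_mult[OF U(1,2)] U(3) by (simp add: unramified_def)
  obtain B where B: "finite B" "B \<subseteq> U \<inter> P 0" "res_indep k B (\<lambda>b. b)"
    and approx: "\<And>x. x \<in> U \<Longrightarrow> x \<in> P 0 \<Longrightarrow>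
      \<exists>c. (\<forall>b\<in>B. c b \<in> k \<inter> P 0) \<and> x - (\<Sum>b\<in>B. c b * b) \<in> P 1"
    using residue_basis_exists[OF U(1,2)] by blast
  have sumU: "(\<Sum>b\<in>B. c b * b) \<in> U" if "\<And>b. b \<in> B \<Longrightarrow> c b \<in> k" for c
    using that U(2) B(2) by (intro U.sum_mem U.mult_mem) auto
  have "\<exists>c. (\<forall>b\<in>B. c b \<in> k) \<and> x = (\<Sum>b\<in>B. c b * b)" if x: "x \<in> U" for x
  proof (rule span_of_residual_span[of B "\<lambda>b. b" U, OF complete_k B(1)])
    fix x assume x: "x \<in> U" "x \<in> P 0"
    obtain c where c: "\<forall>b\<in>B. c b \<in> k \<inter> P 0" "x - (\<Sum>b\<in>B. c b * b) \<in> P 1" using approx[OF x] by blast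
    have "x - (\<Sum>b\<in>B. c b * b) \<in> U" using x(1) sumU[of c] c(1) by blast
    then have "x - (\<Sum>b\<in>B. c b * b) \<in> P (int e)" using U.ideal_mem_vmin c(2) eU by metis
    with c(1) show "\<exists>c. (\<forall>b\<in>B. c b \<in> k \<inter> P 0) \<and> x - (\<Sum>b\<in>B. c b * b) \<in> P (int e)" by blast
  qed (use B(2) U(2) x sumU in auto)
  then show ?thesis using B unfolding spans_over_def by blast
qed

text \<open>A residue basis of \<open>U\<close> stays residually independent over \<open>K\<close>.
  A uniformizer of E written in it has the valuation of one of its coefficients, which is an element
  of \<open>K\<close>.\<close>

lemma e_root_of_tensor_decomposition:
  assumes K: "is_subfield K" "k \<subseteq> K" "totally_ramified v K k"
    and U: "is_subfield U" "k \<subseteq> U" "unramified v U k" and iso: "tensor_iso k K U"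
  shows "\<exists>y \<pi>k. uniformizer_sub k v \<pi>k \<and> y ^ e = \<pi>k"
proof -
  interpret K: valued_subfield v K by (rule valued_subfield_above[OF K(1,2)])
  obtain B where B: "finite B" "B \<subseteq> U \<inter> P 0" "res_indep k B (\<lambda>b. b)" "spans_over k B U"
    using unramified_residue_basis_spans[OF U] by blast
  have riK: "res_indep K B (\<lambda>b. b)"
    using B(2) totally_ramified_residue[OF K] by (intro res_indep_extend[OF B(3)]) auto
  obtain C where C: "basis_over k U C"
    "\<And>x. \<exists>!a. (\<forall>b\<in>C. a b \<in> K) \<and> (\<forall>b. b \<notin> C \<longrightarrow> a b = 0) \<and> x = (\<Sum>b\<in>C. a b * b)"
    using iso unfolding tensor_iso_def by blast
  obtain \<rho> where \<rho>: "\<rho> \<noteq> 0" "v \<rho> = 1" using uniformizer_exists by (auto simp: uniformizer_def)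
  obtain a where a: "\<forall>b\<in>C. a b \<in> K" "\<rho> = (\<Sum>b\<in>C. a b * b)" using ex1_implies_ex[OF C(2)[of \<rho>]] by blast
  have "\<forall>b\<in>C. \<exists>c. (\<forall>b'\<in>B. c b' \<in> k) \<and> b = (\<Sum>b'\<in>B. c b' * b')"
    using B(4) C(1) unfolding spans_over_def basis_over_def by blast
  then obtain c where c: "\<And>b b'. b \<in> C \<Longrightarrow> b' \<in> B \<Longrightarrow> c b b' \<in> k"
    "\<And>b. b \<in> C \<Longrightarrow> b = (\<Sum>b'\<in>B. c b b' * b')" by metis
  \<comment> \<open>The basis \<open>C\<close> supplied by \<open>tensor_iso\<close> is arbitrary;
    the coordinates are transferred to \<open>B\<close>, whose elements are integral and residually
    independent.\<close>
  define d where "d b' = (\<Sum>b\<in>C. a b * c b b')" for b'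
  have d: "d b' \<in> K" if "b' \<in> B" for b'
    unfolding d_def using a(1) c(1)[OF _ that] K(2) by (intro K.sum_mem K.mult_mem) auto
  have "\<rho> = (\<Sum>b\<in>C. a b * (\<Sum>b'\<in>B. c b b' * b'))" unfolding a(2) using c(2) by (intro sum.cong) auto
  also have "\<dots> = (\<Sum>b'\<in>B. d b' * b')"
    unfolding d_def sum_distrib_left sum_distrib_right
    by (subst sum.swap) (simp add: mult.assoc)
  finally have \<rho>_eq: "\<rho> = (\<Sum>b'\<in>B. d b' * b')" .
  have "\<exists>b'\<in>B. d b' \<noteq> 0"
  proof (rule ccontr)
    assume "\<not> (\<exists>b'\<in>B. d b' \<noteq> 0)"
    then have "(\<Sum>b'\<in>B. d b' * b') = 0" by (intro sum.neutral) auto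
    with \<rho>_eq \<rho>(1) show False by simp
  qed
  then obtain b' where b': "b' \<in> B" "d b' \<noteq> 0" "v \<rho> = v (d b')"
    using res_indep_sum_val[OF K.subfield_set_axioms B(1) _ riK, of d] B(2) d \<rho>_eq by auto
  define \<pi> where "\<pi> = d b'"
  have \<pi>: "\<pi> \<in> K" "\<pi> \<noteq> 0" "v \<pi> = 1" using b' d \<rho> by (auto simp: \<pi>_def)
  obtain \<pi>k where \<pi>k: "\<pi>k \<in> k" "\<pi>k \<noteq> 0" "v \<pi>k = int e" using vmin_attained by blast
  define u where "u = \<pi> ^ e / \<pi>k"
  have u: "u \<in> K" "u \<noteq> 0" "v u = 0" using \<pi> \<pi>k K(2) by (auto simp: u_def v_divide v_power)
  \<comment> \<open>\<open>K\<close> has the residue field of k, so \<open>u\<close> is an element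
    of k up to a 1-unit, and 1-units are e-th powers.\<close>
  obtain r where r: "r \<in> k" "u - r \<in> P 1"
    using totally_ramified_residue[OF K u(1)] u by (auto simp: vball_def)
  have r': "r \<noteq> 0" "v r = 0" using unit_cong[OF vball_diff_commute[OF r(2)]] u by auto
  have "u / r - 1 \<in> P 1" using cong_divide[OF r(2) r'] r' by simp
  then obtain w where w: "w ^ e = u / r" "w - 1 \<in> P 1" using e_root_of_one_unit by blast
  have w0: "w \<noteq> 0" using unit_cong[OF w(2)] by auto
  have "(\<pi> / w) ^ e = \<pi>k * r"
    unfolding power_divide w(1) using \<pi> \<pi>k r' by (simp add: u_def)
  moreover have "uniformizer_sub k v (\<pi>k * r)"
    using \<pi>k r r' by (auto simp: uniformizer_sub_def v_mult)
  ultimately show ?thesis by blast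
qed

end

section \<open>The decomposition attached to an e-th root\<close>

context tame_extension
begin

text \<open>A generator \<open>\<zeta>\<close> of the group of roots of unity generates the residue field. Its minimal
  relation over the residue field of \<open>k\<close> divides \<open>X^N - 1\<close>, hence is separable, and a root
  \<open>\<theta>\<close> of a lift of that relation generates the maximal unramified subextension.\<close>

lemma minimal_residual_relation:
  assumes \<zeta>: "\<zeta> ^ N = 1"
  shows "\<exists>g. coeffs_in (k \<inter> P 0) g \<and> lead_coeff g = 1 \<and> poly g \<zeta> \<in> P 1 \<and>
    res_indep k {..<Polynomial.degree g} (\<lambda>i. \<zeta> ^ i)"
proof -
  interpret R: subring_set "k \<inter> P 0" by (rule subring_set_Int_vball[OF subfield_k])
  define Q where "Q d \<longleftrightarrow> (\<exists>c. (\<forall>i<d. c i \<in> k \<inter> P 0) \<and> \<zeta> ^ d - (\<Sum>i<d. c i * \<zeta> ^ i) \<in> P 1)" for d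
  have "Q N"
    unfolding Q_def
  proof (intro exI conjI)
    show "\<forall>i<N. (if i = 0 then 1 else 0) \<in> k \<inter> P 0" by simp
    have "(\<Sum>i<N. (if i = 0 then 1 else 0) * \<zeta> ^ i) = (\<Sum>i<N. if i = 0 then 1 else 0)"
      by (intro sum.cong) auto
    also have "\<dots> = 1" using N_pos by simp
    finally show "\<zeta> ^ N - (\<Sum>i<N. (if i = 0 then 1 else 0) * \<zeta> ^ i) \<in> P 1" using \<zeta> by simp
  qed
  define d where "d = (LEAST d. Q d)"
  have "Q d" unfolding d_def using \<open>Q N\<close> by (rule LeastI)
  have least: "\<not> Q m" if "m < d" for m using that not_less_Least unfolding d_def by blast
  obtain c where c: "\<And>i. i < d \<Longrightarrow> c i \<in> k \<inter> P 0" "\<zeta> ^ d - (\<Sum>i<d. c i * \<zeta> ^ i) \<in> P 1"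
    using \<open>Q d\<close> unfolding Q_def by blast
  have \<zeta>0: "\<zeta> \<in> P 0" using root_of_unity_unit[of \<zeta> N] \<zeta> N_pos
    by (simp add: roots_of_unity_def vball_def)
  define g where "g = monom 1 d - (\<Sum>i<d. monom (c i) i)"
  have cg: "coeff g j = (if j = d then 1 else 0) - (if j < d then c j else 0)" for j
    by (simp add: g_def coeff_sum)
  have deg: "Polynomial.degree g = d"
  proof (rule antisym)
    show "Polynomial.degree g \<le> d" by (rule degree_le) (simp add: cg)
    show "d \<le> Polynomial.degree g" by (rule le_degree) (simp add: cg)
  qed
  have ri: "res_indep k {..<d} (\<lambda>i. \<zeta> ^ i)"
    unfolding res_indep_def
  proof (intro allI impI, rule ccontr)
    fix a assume a: "\<forall>i\<in>{..<d}. a i \<in> k \<inter> P 0" and s: "(\<Sum>i<d. a i * \<zeta> ^ i) \<in> P 1"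
      and "\<not> (\<forall>i\<in>{..<d}. a i \<in> P 1)"
    then have J: "finite {i. i < d \<and> a i \<notin> P 1}" "{i. i < d \<and> a i \<notin> P 1} \<noteq> {}" by auto
    \<comment> \<open>The highest unit coefficient can be made 1. The terms above it lie in p, so a
      relation of degree \<open>m\<close> below the minimal \<open>d\<close> remains.\<close>
    define m where "m = Max {i. i < d \<and> a i \<notin> P 1}"
    have m: "m < d" "a m \<notin> P 1" using Max_in[OF J] by (auto simp: m_def)
    have above: "a i \<in> P 1" if "m < i" "i < d" for i
      using Max_ge[OF J(1), of i] that unfolding m_def by fastforce
    have u: "a m \<noteq> 0" "v (a m) = 0" using unitD a m by auto
    have "{..<d} = {..<m} \<union> {m} \<union> {m<..<d}" using m by auto
    then have "(\<Sum>i<d. a i * \<zeta> ^ i)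
        = (\<Sum>i<m. a i * \<zeta> ^ i) + a m * \<zeta> ^ m + (\<Sum>i\<in>{m<..<d}. a i * \<zeta> ^ i)"
      by (subst \<open>{..<d} = _\<close>, subst sum.union_disjoint, simp, simp, force,
          subst sum.union_disjoint) auto
    moreover have "(\<Sum>i\<in>{m<..<d}. a i * \<zeta> ^ i) \<in> P 1"
      using above \<zeta>0 by (intro vball_sum vball_mult_right) auto
    ultimately have "(\<Sum>i<m. a i * \<zeta> ^ i) + a m * \<zeta> ^ m \<in> P 1"
      using vball_diff[OF s] by fastforce
    from vball_divide_unit[OF this u]
    have "\<zeta> ^ m - (\<Sum>i<m. (- a i / a m) * \<zeta> ^ i) \<in> P 1"
      using u by (simp add: add_divide_distrib sum_divide_distrib sum_negf add.commute)
    moreover have "- a i / a m \<in> k \<inter> P 0" if "i < m" for i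
    proof -
      have "a i \<in> k \<inter> P 0" "a m \<in> k" using a that m by auto
      then show ?thesis using u by (auto intro!: vball_divide_unit)
    qed
    ultimately have "Q m" unfolding Q_def by (intro exI[of _ "\<lambda>i. - a i / a m"]) blast
    then show False using least[OF m(1)] by simp
  qed
  show ?thesis
  proof (intro exI[of _ g] conjI)
    show "coeffs_in (k \<inter> P 0) g" unfolding coeffs_in_def cg using c(1)
      by (auto simp del: Int_iff)
    show "lead_coeff g = 1" by (simp add: deg cg)
    show "poly g \<zeta> \<in> P 1" using c(2) by (simp add: g_def poly_sum poly_monom)
    show "res_indep k {..<Polynomial.degree g} (\<lambda>i. \<zeta> ^ i)" using ri by (simp add: deg)
  qed
qed

lemma poly_ideal_mem: "coeffs_in (P 1) r \<Longrightarrow> x \<in> P 0 \<Longrightarrow> poly r x \<in> P 1"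
  unfolding poly_altdef coeffs_in_def by (intro vball_sum vball_mult_right) auto

text \<open>Dividing X^N - 1 by g leaves a remainder that lies in p at \<open>\<zeta>\<close> and
  so, by residual independence, has all coefficients in p. If the derivative of g at
  \<open>\<zeta>\<close> were in p, that of X^N - 1 would be too, although N is a unit.\<close>

lemma minimal_residual_relation_separable:
  assumes \<zeta>: "\<zeta> ^ N = 1" and g: "coeffs_in (k \<inter> P 0) g" "lead_coeff g = 1" "poly g \<zeta> \<in> P 1"
    and ri: "res_indep k {..<Polynomial.degree g} (\<lambda>i. \<zeta> ^ i)"
  shows "poly (pderiv g) \<zeta> \<notin> P 1"
proof
  assume g': "poly (pderiv g) \<zeta> \<in> P 1"
  interpret R: subring_set "k \<inter> P 0" by (rule subring_set_Int_vball[OF subfield_k])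
  interpret O: subring_set "P 0" by (rule subring_set_vball)
  have \<zeta>u: "\<zeta> \<noteq> 0" "v \<zeta> = 0" using root_of_unity_unit[of \<zeta> N] \<zeta> N_pos
    by (auto simp: roots_of_unity_def)
  have \<zeta>0: "\<zeta> \<in> P 0" using \<zeta>u by (simp add: vball_def)
  define f :: "'a poly" where "f = monom 1 N - 1"
  have "coeffs_in (k \<inter> P 0) f"
    unfolding f_def by (intro R.coeffs_in_diff R.coeffs_in_monom R.one_mem R.coeffs_in_1)
  then obtain h r where hr: "coeffs_in (k \<inter> P 0) h" "coeffs_in (k \<inter> P 0) r" "f = g * h + r"
    "\<forall>i\<ge>Polynomial.degree g. coeff r i = 0"
    using R.monic_division[OF g(1,2)] by blast
  have hO: "coeffs_in (P 0) h" using hr(1) by (auto simp: coeffs_in_def)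
  have "poly f \<zeta> = 0" using \<zeta> by (simp add: f_def poly_monom)
  then have "poly r \<zeta> = - (poly g \<zeta> * poly h \<zeta>)" unfolding hr(3) by (simp add: eq_neg_iff_add_eq_0 add.commute)
  then have "poly r \<zeta> \<in> P 1" using vball_mult_right[OF g(3) O.poly_mem[OF hO \<zeta>0]] by auto
  then have "(\<Sum>i<Polynomial.degree g. coeff r i * \<zeta> ^ i) \<in> P 1"
    using poly_eq_sum_lessThan[OF hr(4)] by simp
  then have "coeff r i \<in> P 1" if "i < Polynomial.degree g" for i
    using res_indepD[OF ri, of "coeff r" i] hr(2) that by (auto simp: coeffs_in_def)
  then have rP: "coeff r i \<in> P 1" for i using hr(4) by (cases "i < Polynomial.degree g") auto
  then have "coeffs_in (P 1) (pderiv r)"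
    by (auto simp: coeffs_in_def coeff_pderiv simp del: of_nat_Suc intro!: vball_mult_left vball_of_nat)
  then have r': "poly (pderiv r) \<zeta> \<in> P 1" using poly_ideal_mem \<zeta>0 by blast
  have "poly (pderiv f) \<zeta> = poly g \<zeta> * poly (pderiv h) \<zeta> + poly h \<zeta> * poly (pderiv g) \<zeta> + poly (pderiv r) \<zeta>"
    unfolding hr(3) by (simp add: pderiv_add pderiv_mult)
  also have "\<dots> \<in> P 1"
    using g(3) g' r' O.poly_mem[OF hO \<zeta>0] O.poly_mem[OF O.coeffs_in_pderiv[OF hO] \<zeta>0]
    by (intro vball_add vball_mult_left[of "poly h \<zeta>"] vball_mult_right[of "poly g \<zeta>"])
  finally have "of_nat N * \<zeta> ^ (N - 1) \<in> P 1"
    by (simp add: f_def pderiv_diff pderiv_monom poly_monom)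
  then show False
    using unitD[OF vball_of_nat of_nat_N] \<zeta>u by (auto simp: vball_def v_mult v_power)
qed

text \<open>Powers of \<open>\<theta>\<close> are congruent to those of \<open>\<zeta>\<close>, so
  residual independence carries over. Every unit is congruent to a power of \<open>\<zeta>\<close>;
  dividing X^j by g and evaluating at the exact root \<open>\<theta>\<close> leaves only powers
  below the degree.\<close>

lemma unramified_generator_exists:
  "\<exists>\<theta> g. coeffs_in (k \<inter> P 0) g \<and> lead_coeff g = 1 \<and> poly g \<theta> = 0 \<and> \<theta> \<in> P 0 \<and>
     res_indep k {..<Polynomial.degree g} (\<lambda>i. \<theta> ^ i) \<and>
     (\<forall>x\<in>P 0. \<exists>c. (\<forall>i<Polynomial.degree g. c i \<in> k \<inter> P 0) \<and>
        x - (\<Sum>i<Polynomial.degree g. c i * \<theta> ^ i) \<in> P 1)"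
proof -
  interpret R: subring_set "k \<inter> P 0" by (rule subring_set_Int_vball[OF subfield_k])
  obtain \<zeta> where \<zeta>: "\<zeta> ^ N = 1" "\<forall>x\<in>\<mu>. \<exists>i. x = \<zeta> ^ i"
    using roots_of_unity_cyclic[OF N_pos card_mu] by blast
  have \<zeta>0: "\<zeta> \<in> P 0" using root_of_unity_unit[of \<zeta> N] \<zeta> N_pos
    by (simp add: roots_of_unity_def vball_def)
  obtain g where g: "coeffs_in (k \<inter> P 0) g" "lead_coeff g = 1" "poly g \<zeta> \<in> P 1"
    and ri: "res_indep k {..<Polynomial.degree g} (\<lambda>i. \<zeta> ^ i)"
    using minimal_residual_relation[OF \<zeta>(1)] by blast
  let ?d = "Polynomial.degree g"
  have "coeffs_in (UNIV \<inter> P 0) g" using g(1) by (auto simp: coeffs_in_def)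
  then obtain \<theta> where \<theta>: "\<theta> \<in> P 0" "poly g \<theta> = 0" "\<theta> - \<zeta> \<in> P 1"
    using hensel[OF subfield_UNIV complete_E _ UNIV_I \<zeta>0 g(3)
        minimal_residual_relation_separable[OF \<zeta>(1) g ri]] by blast
  have pw: "\<theta> ^ i - \<zeta> ^ i \<in> P 1" for i using cong_power[OF \<theta>(3,1) \<zeta>0] .
  have "res_indep k {..<?d} (\<lambda>i. \<theta> ^ i)"
    unfolding res_indep_def
  proof (intro allI impI)
    fix c assume c: "\<forall>i\<in>{..<?d}. c i \<in> k \<inter> P 0" and s: "(\<Sum>i<?d. c i * \<theta> ^ i) \<in> P 1"
    have "(\<Sum>i<?d. c i * (\<theta> ^ i - \<zeta> ^ i)) \<in> P 1"
      using c pw by (intro vball_sum vball_mult_left) auto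
    then have "(\<Sum>i<?d. c i * \<zeta> ^ i) \<in> P 1"
      using vball_diff[OF s, of "\<Sum>i<?d. c i * (\<theta> ^ i - \<zeta> ^ i)"]
      by (simp add: right_diff_distrib sum_subtractf)
    then show "\<forall>i\<in>{..<?d}. c i \<in> P 1" using res_indepD[OF ri, of c] c by blast
  qed
  moreover have "\<exists>c. (\<forall>i<?d. c i \<in> k \<inter> P 0) \<and> x - (\<Sum>i<?d. c i * \<theta> ^ i) \<in> P 1" if x: "x \<in> P 0" for x
  proof (cases "x \<in> P 1")
    case True
    then show ?thesis by (intro exI[of _ "\<lambda>_. 0"]) simp
  next
    case False
    then obtain j where j: "x - \<zeta> ^ j \<in> P 1" using teichmuller_E unitD[OF x] \<zeta>(2) by metis
    obtain h r where hr: "coeffs_in (k \<inter> P 0) r" "monom 1 j = g * h + r" "\<forall>i\<ge>?d. coeff r i = 0"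
      using R.monic_division[OF g(1,2), of "monom 1 j"] R.coeffs_in_monom[OF R.one_mem] by blast
    have "\<theta> ^ j = poly (monom 1 j) \<theta>" by (simp add: poly_monom)
    also have "\<dots> = poly r \<theta>" unfolding hr(2) using \<theta>(2) by simp
    also have "\<dots> = (\<Sum>i<?d. coeff r i * \<theta> ^ i)" by (rule poly_eq_sum_lessThan[OF hr(3)])
    finally have "x - (\<Sum>i<?d. coeff r i * \<theta> ^ i) \<in> P 1"
      using vball_trans[OF j vball_diff_commute[OF pw[of j]]] by simp
    then show ?thesis using hr(1) unfolding coeffs_in_def by (intro exI[of _ "coeff r"]) blast
  qed
  ultimately show ?thesis using g(1,2) \<theta>(1,2) by blast
qed

text \<open>A y-adic expansion with digits in the span of the powers of \<open>\<theta>\<close>.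
  With n = e the error becomes divisible by a uniformizer of k, as approximation over k
  requires.\<close>

lemma powers_residual_span:
  assumes y: "y \<noteq> 0" "v y = 1"
    and span: "\<And>x. x \<in> P 0 \<Longrightarrow> \<exists>c. (\<forall>i<d. c i \<in> k \<inter> P 0) \<and> x - (\<Sum>i<d. c i * \<theta> ^ i) \<in> P 1"
    and x: "x \<in> P 0"
  shows "\<exists>c. (\<forall>j<n. \<forall>i<d. c j i \<in> k \<inter> P 0) \<and>
    x - (\<Sum>j<n. \<Sum>i<d. c j i * (y ^ j * \<theta> ^ i)) \<in> P (int n)"
proof (induction n)
  case 0
  then show ?case using x by simp
next
  case (Suc n)
  then obtain c where c: "\<forall>j<n. \<forall>i<d. c j i \<in> k \<inter> P 0"
    "x - (\<Sum>j<n. \<Sum>i<d. c j i * (y ^ j * \<theta> ^ i)) \<in> P (int n)" by blast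
  define z where "z = (x - (\<Sum>j<n. \<Sum>i<d. c j i * (y ^ j * \<theta> ^ i))) / y ^ n"
  have zy: "y ^ n * z = x - (\<Sum>j<n. \<Sum>i<d. c j i * (y ^ j * \<theta> ^ i))" using y by (simp add: z_def)
  have "z \<in> P 0"
    using vball_mult[OF c(2), of "inverse (y ^ n)" "- int n"] y
    by (simp add: z_def divide_inverse vball_def[of v "- int n"] v_inverse v_power)
  then obtain b where b: "\<forall>i<d. b i \<in> k \<inter> P 0" "z - (\<Sum>i<d. b i * \<theta> ^ i) \<in> P 1" using span by blast
  define c' where "c' = c(n := b)"
  have "(\<Sum>j<n. \<Sum>i<d. c' j i * (y ^ j * \<theta> ^ i)) = (\<Sum>j<n. \<Sum>i<d. c j i * (y ^ j * \<theta> ^ i))"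
    by (intro sum.cong) (auto simp: c'_def)
  moreover have "(\<Sum>i<d. c' n i * (y ^ n * \<theta> ^ i)) = y ^ n * (\<Sum>i<d. b i * \<theta> ^ i)"
    by (simp add: c'_def sum_distrib_left mult_ac)
  ultimately have "x - (\<Sum>j<Suc n. \<Sum>i<d. c' j i * (y ^ j * \<theta> ^ i))
      = (z - (\<Sum>i<d. b i * \<theta> ^ i)) * y ^ n"
    using zy by (simp add: mult.commute[of _ "y ^ n"] right_diff_distrib)
  also have "\<dots> \<in> P (1 + int n)"
    using y by (intro vball_mult b(2)) (simp add: vball_def v_power)
  finally have "x - (\<Sum>j<Suc n. \<Sum>i<d. c' j i * (y ^ j * \<theta> ^ i)) \<in> P (int (Suc n))" by (simp add: add.commute)
  moreover have "\<forall>j<Suc n. \<forall>i<d. c' j i \<in> k \<inter> P 0" using b(1) c(1) by (auto simp: c'_def less_Suc_eq)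
  ultimately show ?case by blast
qed

text \<open>Division by X^e - y^e leaves e powers of y that span, and their valuations, distinct
  modulo e, make them independent. As v y = 1, degree and ramification index are both e.\<close>

lemma adjoin_root_totally_ramified:
  assumes y: "y \<noteq> 0" "v y = 1" "y ^ e \<in> k"
  shows "is_subfield (adjoin y)" "totally_ramified v (adjoin y) k"
proof -
  define g where "g = monom 1 e - [:y ^ e:]"
  have deg: "Polynomial.degree g = e"
    unfolding g_def using vmin_pos
    by (subst diff_conv_add_uminus, subst degree_add_eq_left) (auto simp: degree_monom_eq)
  have g: "coeffs_in k g" "lead_coeff g = 1" "poly g y = 0"
  proof -
    show "coeffs_in k g"
      unfolding g_def using y by (intro coeffs_in_diff coeffs_in_monom) (auto simp: coeffs_in_pCons_iff)
    show "lead_coeff g = 1"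
      unfolding deg using vmin_pos by (auto simp: g_def coeff_pCons split: nat.split)
    show "poly g y = 0" by (simp add: g_def poly_monom)
  qed
  show sub: "is_subfield (adjoin y)" by (rule subring_is_subfield[OF fin_ext subring_adjoin subset_adjoin])
  interpret K: valued_subfield v "adjoin y" by (rule valued_subfield_above[OF sub subset_adjoin])
  have vK: "vmin (adjoin y) v = 1" using K.vmin_dvd[OF mem_adjoin y(1)] y by simp
  have inj: "inj_on (\<lambda>i. y ^ i) {..<e}" using powers_inj[of y 1] y by simp
  have "basis_over k (adjoin y) ((\<lambda>i. y ^ i) ` {..<e})"
    unfolding basis_over_def
  proof (intro conjI)
    show "(\<lambda>i. y ^ i) ` {..<e} \<subseteq> adjoin y" using mem_adjoin K.power_mem by auto
    show "lin_indep_over k ((\<lambda>i. y ^ i) ` {..<e})" using powers_lin_indep[of y 1 e] y by simp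
    show "spans_over k ((\<lambda>i. y ^ i) ` {..<e}) (adjoin y)"
      unfolding spans_over_def
    proof
      fix x assume "x \<in> adjoin y"
      then obtain c where c: "\<forall>i. c i \<in> k" "x = (\<Sum>i<e. c i * y ^ i)"
        using adjoin_spanned_by_powers[OF g] by (auto simp: deg)
      \<comment> \<open>Bases are sets, so coefficients are indexed by basis elements; injectivity
        of the powers recovers the exponent.\<close>
      let ?c = "\<lambda>b. c (the_inv_into {..<e} (\<lambda>i. y ^ i) b)"
      have "x = (\<Sum>b\<in>(\<lambda>i. y ^ i) ` {..<e}. ?c b * b)"
        unfolding c(2) by (simp add: sum.reindex[OF inj] the_inv_into_f_f[OF inj])
      then show "\<exists>c. (\<forall>b\<in>(\<lambda>i. y ^ i) ` {..<e}. c b \<in> k) \<and> x = (\<Sum>b\<in>(\<lambda>i. y ^ i) ` {..<e}. c b * b)"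
        using c(1) by (intro exI[of _ ?c]) simp
    qed
  qed simp
  then have "Defs.degree k (adjoin y) = e" by (simp add: degree_eq_card card_image[OF inj])
  then show "totally_ramified v (adjoin y) k" by (simp add: totally_ramified_def ram_index_def vK)
qed

text \<open>By \<open>res_indep_sum_val\<close> a nonzero element of \<open>adjoin \<theta>\<close>
  has the valuation of one of its coefficients in k, so no new values appear.\<close>

lemma adjoin_unramified:
  assumes g: "coeffs_in (k \<inter> P 0) g" "lead_coeff g = 1" "poly g \<theta> = 0" "\<theta> \<in> P 0"
    and ri: "res_indep k {..<Polynomial.degree g} (\<lambda>i. \<theta> ^ i)"
  shows "is_subfield (adjoin \<theta>)" "unramified v (adjoin \<theta>) k"
    "inj_on (\<lambda>i. \<theta> ^ i) {..<Polynomial.degree g}"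
    "basis_over k (adjoin \<theta>) ((\<lambda>i. \<theta> ^ i) ` {..<Polynomial.degree g})"
proof -
  let ?d = "Polynomial.degree g" let ?B = "(\<lambda>i. \<theta> ^ i) ` {..<?d}"
  have gk: "coeffs_in k g" using g(1) by (auto simp: coeffs_in_def)
  show sub: "is_subfield (adjoin \<theta>)" by (rule subring_is_subfield[OF fin_ext subring_adjoin subset_adjoin])
  interpret U: valued_subfield v "adjoin \<theta>" by (rule valued_subfield_above[OF sub subset_adjoin])
  have \<theta>P: "\<theta> ^ i \<in> P 0" for i using g(4) by auto
  obtain u where u: "u \<in> adjoin \<theta>" "u \<noteq> 0" "v u = int (vmin (adjoin \<theta>) v)" using U.vmin_attained by blast
  obtain c where c: "\<forall>i. c i \<in> k" "u = (\<Sum>i<?d. c i * \<theta> ^ i)"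
    using adjoin_spanned_by_powers[OF gk g(2,3) u(1)] by blast
  have "\<exists>i\<in>{..<?d}. c i \<noteq> 0"
  proof (rule ccontr)
    assume "\<not> ?thesis"
    then have "u = 0" unfolding c(2) by (intro sum.neutral) auto
    with u(2) show False by simp
  qed
  then obtain i where i: "c i \<noteq> 0" "v u = v (c i)"
    using res_indep_sum_val[OF subfield_k _ \<theta>P ri, of c] c by auto
  then have "int e dvd int (vmin (adjoin \<theta>) v)" using vmin_dvd[of "c i"] c(1) u(3) by metis
  then have "e dvd vmin (adjoin \<theta>) v" by simp
  then have "vmin (adjoin \<theta>) v = e" using vmin_dvd_vmin_k[OF sub subset_adjoin] by (simp add: dvd_antisym)
  then show "unramified v (adjoin \<theta>) k" using vmin_pos by (simp add: unramified_def ram_index_def)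
  show inj: "inj_on (\<lambda>i. \<theta> ^ i) {..<?d}"
  proof (rule inj_onI, rule ccontr)
    fix i j assume ij: "i \<in> {..<?d}" "j \<in> {..<?d}" "\<theta> ^ i = \<theta> ^ j" "i \<noteq> j"
    \<comment> \<open>Two equal powers would give a vanishing combination with the unit coefficients
      1 and -1.\<close>
    define a :: "nat \<Rightarrow> 'a" where "a = (\<lambda>l. if l = i then 1 else if l = j then - 1 else 0)"
    have "(\<Sum>l<?d. a l * \<theta> ^ l) = (\<Sum>l\<in>{i, j}. a l * \<theta> ^ l)"
      using ij by (intro sum.mono_neutral_right) (auto simp: a_def)
    also have "\<dots> = 0" using ij by (simp add: a_def)
    finally have s: "(\<Sum>l<?d. a l * \<theta> ^ l) \<in> P 1" by simp
    have "a l \<in> k \<inter> P 0" for l by (auto simp: a_def vball_def)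
    then have "a i \<in> P 1" using res_indepD[OF ri _ s ij(1)] by blast
    then show False by (simp add: a_def)
  qed
  show "basis_over k (adjoin \<theta>) ?B"
    unfolding basis_over_def
  proof (intro conjI)
    show "?B \<subseteq> adjoin \<theta>" using mem_adjoin U.power_mem by auto
    show "lin_indep_over k ?B"
      using \<theta>P by (intro res_indep_imp_lin_indep[OF subfield_k _ _ res_indep_image[OF inj ri]]) auto
    show "spans_over k ?B (adjoin \<theta>)"
      unfolding spans_over_def
    proof
      fix x assume "x \<in> adjoin \<theta>"
      then obtain c where c: "\<forall>i. c i \<in> k" "x = (\<Sum>i<?d. c i * \<theta> ^ i)"
        using adjoin_spanned_by_powers[OF gk g(2,3)] by blast
      let ?c = "\<lambda>b. c (the_inv_into {..<?d} (\<lambda>i. \<theta> ^ i) b)"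
      have "x = (\<Sum>b\<in>?B. ?c b * b)"
        unfolding c(2) by (simp add: sum.reindex[OF inj] the_inv_into_f_f[OF inj])
      then show "\<exists>c. (\<forall>b\<in>?B. c b \<in> k) \<and> x = (\<Sum>b\<in>?B. c b * b)"
        using c(1) by (intro exI[of _ ?c]) simp
    qed
  qed simp
qed

text \<open>The products y^j \<theta>^i span E over k, because they do so modulo a uniformizer of k
  and k is complete; collecting powers of y gives coefficients in K. Uniqueness is the residual
  independence of the powers of \<open>\<theta>\<close> over K, which has the residue field of
  k.\<close>

lemma tensor_decomposition_of_e_root:
  assumes \<pi>k: "uniformizer_sub k v \<pi>k" and root: "y ^ e = \<pi>k"
  shows "\<exists>K U. is_subfield K \<and> is_subfield U \<and> k \<subseteq> K \<and> k \<subseteq> U \<and>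
    totally_ramified v K k \<and> unramified v U k \<and> tensor_iso k K U"
proof -
  have \<pi>k': "\<pi>k \<in> k" "\<pi>k \<noteq> 0" "v \<pi>k = int e" using \<pi>k by (auto simp: uniformizer_sub_def)
  have y0: "y \<noteq> 0" using root \<pi>k' vmin_pos by (auto simp: power_0_left)
  have vy: "v y = 1" using v_power[OF y0, of e] root \<pi>k' vmin_pos by simp
  have yk: "y ^ e \<in> k" using root \<pi>k' by simp
  note K = adjoin_root_totally_ramified[OF y0 vy yk]
  interpret K: valued_subfield v "adjoin y" by (rule valued_subfield_above[OF K(1) subset_adjoin])
  obtain \<theta> g where g: "coeffs_in (k \<inter> P 0) g" "lead_coeff g = 1" "poly g \<theta> = 0" "\<theta> \<in> P 0"
    and ri: "res_indep k {..<Polynomial.degree g} (\<lambda>i. \<theta> ^ i)"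
    and span: "\<And>x. x \<in> P 0 \<Longrightarrow> \<exists>c. (\<forall>i<Polynomial.degree g. c i \<in> k \<inter> P 0) \<and>
        x - (\<Sum>i<Polynomial.degree g. c i * \<theta> ^ i) \<in> P 1"
    using unramified_generator_exists by blast
  note U = adjoin_unramified[OF g ri]
  define d where "d = Polynomial.degree g"
  define B where "B = (\<lambda>i. \<theta> ^ i) ` {..<d}"
  have inj: "inj_on (\<lambda>i. \<theta> ^ i) {..<d}" using U(3) by (simp add: d_def)
  have \<theta>P: "\<theta> ^ i \<in> P 0" for i using g(4) by auto
  have yP: "y ^ j \<in> P 0" for j using y0 vy by (simp add: vball_def v_power)
  have riK: "res_indep (adjoin y) B (\<lambda>b. b)"
  proof (rule res_indep_extend)
    show "res_indep k B (\<lambda>b. b)" unfolding B_def using res_indep_image[OF U(3) ri] by (simp add: d_def)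
    show "b \<in> P 0" if "b \<in> B" for b using that \<theta>P by (auto simp: B_def)
  qed (rule totally_ramified_residue[OF K(1) subset_adjoin K(2)])
  have exists: "\<exists>A. (\<forall>i. A i \<in> adjoin y) \<and> x = (\<Sum>i<d. A i * \<theta> ^ i)" for x
  proof -
    let ?I = "{..<e} \<times> {..<d}" and ?w = "\<lambda>(j, i). y ^ j * \<theta> ^ i"
    have "\<exists>c. (\<forall>p\<in>?I. c p \<in> k) \<and> x = (\<Sum>p\<in>?I. c p * ?w p)"
    proof (rule span_of_residual_span[of ?I ?w UNIV, OF complete_k])
      fix x :: 'a assume "x \<in> P 0"
      then obtain c where c: "\<forall>j<e. \<forall>i<d. c j i \<in> k \<inter> P 0"
        "x - (\<Sum>j<e. \<Sum>i<d. c j i * (y ^ j * \<theta> ^ i)) \<in> P (int e)"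
        using powers_residual_span[OF y0 vy span, of x e] unfolding d_def by blast
      have "(\<Sum>j<e. \<Sum>i<d. c j i * (y ^ j * \<theta> ^ i)) = (\<Sum>p\<in>?I. (case p of (j, i) \<Rightarrow> c j i) * ?w p)"
        by (simp add: sum.cartesian_product split_def)
      then show "\<exists>c. (\<forall>p\<in>?I. c p \<in> k \<inter> P 0) \<and> x - (\<Sum>p\<in>?I. c p * ?w p) \<in> P (int e)"
        using c by (intro exI[of _ "\<lambda>(j, i). c j i"]) auto
    qed (use yP \<theta>P in \<open>auto intro: vball_mult_left\<close>)
    then obtain c where c: "\<forall>p\<in>?I. c p \<in> k" "x = (\<Sum>p\<in>?I. c p * ?w p)" by blast
    define A where "A i = (if i < d then \<Sum>j<e. c (j, i) * y ^ j else 0)" for i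
    have "A i \<in> adjoin y" for i
      unfolding A_def using c(1) subset_adjoin[of y] mem_adjoin[of y]
      by (auto intro!: K.sum_mem K.mult_mem K.power_mem)
    moreover have "x = (\<Sum>j<e. \<Sum>i<d. c (j, i) * (y ^ j * \<theta> ^ i))"
      unfolding c(2) by (simp add: sum.cartesian_product split_def)
    then have "x = (\<Sum>i<d. A i * \<theta> ^ i)"
      by (subst (asm) sum.swap) (simp add: A_def sum_distrib_right mult.assoc)
    ultimately show ?thesis by blast
  qed
  have "\<exists>!a. (\<forall>b\<in>B. a b \<in> adjoin y) \<and> (\<forall>b. b \<notin> B \<longrightarrow> a b = 0) \<and> x = (\<Sum>b\<in>B. a b * b)" for x
  proof (rule ex_ex1I)
    obtain A where A: "\<forall>i. A i \<in> adjoin y" "x = (\<Sum>i<d. A i * \<theta> ^ i)" using exists[of x] by blast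
    define a where "a b = (if b \<in> B then A (the_inv_into {..<d} (\<lambda>i. \<theta> ^ i) b) else 0)" for b
    have "(\<Sum>b\<in>B. a b * b) = x"
      unfolding A(2) B_def by (simp add: sum.reindex[OF inj] a_def B_def the_inv_into_f_f[OF inj])
    then show "\<exists>a. (\<forall>b\<in>B. a b \<in> adjoin y) \<and> (\<forall>b. b \<notin> B \<longrightarrow> a b = 0) \<and> x = (\<Sum>b\<in>B. a b * b)"
      using A(1) by (intro exI[of _ a]) (auto simp: a_def)
  next
    fix a a' assume a: "(\<forall>b\<in>B. a b \<in> adjoin y) \<and> (\<forall>b. b \<notin> B \<longrightarrow> a b = 0) \<and> x = (\<Sum>b\<in>B. a b * b)"
      and a': "(\<forall>b\<in>B. a' b \<in> adjoin y) \<and> (\<forall>b. b \<notin> B \<longrightarrow> a' b = 0) \<and> x = (\<Sum>b\<in>B. a' b * b)"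
    have "(\<Sum>b\<in>B. (a b - a' b) * b) = 0" using a a' by (simp add: left_diff_distrib sum_subtractf)
    moreover have "lin_indep_over (adjoin y) B"
      using \<theta>P by (intro res_indep_imp_lin_indep[OF K.subfield_set_axioms _ _ riK]) (auto simp: B_def)
    moreover have "\<forall>b\<in>B. a b - a' b \<in> adjoin y" using a a' by auto
    ultimately have "\<forall>b\<in>B. a b - a' b = 0"
      using spec[of _ "\<lambda>b. a b - a' b"] unfolding lin_indep_over_def by blast
    then show "a = a'" using a a' by (metis ext right_minus_eq)
  qed
  then have "tensor_iso k (adjoin y) (adjoin \<theta>)"
    using U(4) unfolding tensor_iso_def d_def[symmetric] B_def[symmetric] by blast
  then show ?thesis using K U(1,2) subset_adjoin by blast
qed

end

theorem mainTheorem16: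
  fixes k :: "'a::field set" and v :: "'a \<Rightarrow> int"
  assumes "nonarch_local_field v"
    and "nonarch_local_subfield k v"
    and "finite_ext k UNIV"
    and "tamely_ramified v UNIV k"
  shows "mu_tame k v \<noteq> {}
    \<and> (\<exists>x\<in>roots_of_unity (res_card UNIV v - 1).
          mu_tame k v = {y \<in> roots_of_unity (res_card UNIV v - 1). sim_rel k v y x})
    \<and> ((\<exists>K U. is_subfield K \<and> is_subfield U \<and> k \<subseteq> K \<and> k \<subseteq> U \<and>
            totally_ramified v K k \<and> unramified v U k \<and> tensor_iso k K U)
       \<longleftrightarrow> (\<exists>y \<pi>k. uniformizer_sub k v \<pi>k \<and> y ^ ram_index v UNIV k = \<pi>k))
    \<and> ((\<exists>y \<pi>k. uniformizer_sub k v \<pi>k \<and> y ^ ram_index v UNIV k = \<pi>k)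
       \<longleftrightarrow> 1 \<in> mu_tame k v)
    \<and> (1 \<in> mu_tame k v
       \<longleftrightarrow> (\<exists>\<pi>E \<pi>k. uniformizer v \<pi>E \<and> uniformizer_sub k v \<pi>k \<and>
             (\<pi>E ^ ram_index v UNIV k / \<pi>k) ^ ((res_card UNIV v - 1) div e_tilde k v) - 1
               \<in> val_ideal v))
    \<and> ((\<exists>\<pi>E \<pi>k. uniformizer v \<pi>E \<and> uniformizer_sub k v \<pi>k \<and>
             (\<pi>E ^ ram_index v UNIV k / \<pi>k) ^ ((res_card UNIV v - 1) div e_tilde k v) - 1
               \<in> val_ideal v)
       \<longleftrightarrow> (\<forall>\<pi>E \<pi>k. uniformizer v \<pi>E \<longrightarrow> uniformizer_sub k v \<pi>k \<longrightarrow>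
             (\<pi>E ^ ram_index v UNIV k / \<pi>k) ^ ((res_card UNIV v - 1) div e_tilde k v) - 1
               \<in> val_ideal v))"
proof -
  interpret tame_extension k v using assms by unfold_locales
  obtain x where x: "x \<in> \<mu>" "x \<in> mu_tame k v" "mu_tame k v = {y \<in> \<mu>. sim_rel k v y x}"
    using mu_tame_class by blast
  \<comment> \<open>A pair of uniformizers exists, so the universal condition is not vacuous and
    implies the existential one.\<close>
  obtain \<rho> \<rho>k where \<rho>: "uniformizer v \<rho>" "uniformizer_sub k v \<rho>k"
    using uniformizer_exists uniformizer_sub_exists by blast
  show ?thesis
    unfolding ram_index_UNIV val_ideal_eq_vball
  proof (intro conjI)
    show "mu_tame k v \<noteq> {}" using x(2) by blast
    show "\<exists>x\<in>\<mu>. mu_tame k v = {y \<in> \<mu>. sim_rel k v y x}" using x by blast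
    show "(\<exists>K U. is_subfield K \<and> is_subfield U \<and> k \<subseteq> K \<and> k \<subseteq> U \<and>
        totally_ramified v K k \<and> unramified v U k \<and> tensor_iso k K U)
      \<longleftrightarrow> (\<exists>y \<pi>k. uniformizer_sub k v \<pi>k \<and> y ^ e = \<pi>k)"
      using e_root_of_tensor_decomposition tensor_decomposition_of_e_root by blast
  qed (use one_mem_mu_tame_iff \<rho> e_root_iff_one_mem_mu_tame in blast)+
qed

end
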